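(* Let $d\ge2$. Then there exists a constant $c$ such that $$|x|^{d-1}|f(x)|\le c\,\|f|BV(\mathbb{R}^d)\|$$ holds for all $|x|>0$ and all $f\in RBV(\mathbb{R}^d)$. Also $$\lim_{|x|\to\infty}|x|^{d-1}|f(x)|=0$$ is true for all $f\in RBV(\mathbb{R}^d)$.
   Context: $BV(\mathbb{R}^d)$ is the space of all (equivalence classes of) $g\in L_1(\mathbb{R}^d)$ such that for every $i=1,\dots,d$ there is a signed Radon measure $\mu_i$ of finite total variation with $\int_{\mathbb{R}^d}g(x)\frac{\partial\phi}{\partial x_i}(x)\,dx=-\int_{\mathbb{R}^d}\phi(x)\,d\mu_i(x)$ for all continuously differentiable, compactly supported $\phi$ on $\mathbb{R}^d$. The norm is $\|g|BV(\mathbb{R}^d)\|=\|g|L_1(\mathbb{R}^d)\|+\sum_{i=1}^d\|\mu_i|\mathcal{M}\|$, where $\|\mu_i|\mathcal{M}\|$ is the total variation of $\mu_i$. $RBV(\mathbb{R}^d)$ is the subset of radial elements, with the same norm. Pointwise values $f(x)$ are understood as values of the following representative $\tilde f$ of the class $[f]$: $\tilde f(x)=f(x)$ at every Lebesgue point $x$ of $f$ and $\tilde f(x)=0$ otherwise. *)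

theory Defs
  imports "HOL-Analysis.Analysis"
begin

text \<open>
  A finite signed Borel measure is a real-valued set function of which only the values on
  Borel sets are relevant. Its total variation measure is
  \<open>|\<mu>|(A) = sup \<Sum>\<^sub>i |\<mu>(E\<^sub>i)|\<close> over all countable Borel partitions \<open>(E\<^sub>i)\<close> of \<open>A\<close>.
\<close>

definition variation :: "('a::topological_space set \<Rightarrow> real) \<Rightarrow> 'a set \<Rightarrow> ennreal" where
  "variation \<mu> A =
     (SUP E \<in> {E :: nat \<Rightarrow> 'a set. range E \<subseteq> sets borel \<and> disjoint_family E \<and> (\<Union>i. E i) = A}.
        \<Sum>i. ennreal \<bar>\<mu> (E i)\<bar>)"

definition finite_signed_radon :: "('a::topological_space set \<Rightarrow> real) \<Rightarrow> bool" where
  "finite_signed_radon \<mu> \<longleftrightarrow>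
     \<mu> {} = 0 \<and>
     (\<forall>E :: nat \<Rightarrow> 'a set. range E \<subseteq> sets borel \<longrightarrow> disjoint_family E \<longrightarrow>
        (\<lambda>i. \<mu> (E i)) sums \<mu> (\<Union>i. E i)) \<and>
     variation \<mu> UNIV < \<infinity> \<and>
     (\<forall>A \<in> sets borel. \<forall>e>0. \<exists>K. compact K \<and> K \<subseteq> A \<and> variation \<mu> (A - K) < ennreal e)"

definition total_variation :: "('a::topological_space set \<Rightarrow> real) \<Rightarrow> real" where
  "total_variation \<mu> = enn2real (variation \<mu> UNIV)"

text \<open>
  Jordan decomposition \<open>\<mu>\<^sup>+ = (|\<mu>| + \<mu>)/2\<close>, \<open>\<mu>\<^sup>- = (|\<mu>| - \<mu>)/2\<close>. For a finite signed
  measure both are countably additive and nonnegative on the Borel sets, so that the default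
  value of \<^const>\<open>measure_of\<close> (the null measure) is not used.
\<close>

definition jordan_pos :: "('a::topological_space set \<Rightarrow> real) \<Rightarrow> 'a measure" where
  "jordan_pos \<mu> =
     measure_of UNIV (sets borel) (\<lambda>A. ennreal ((enn2real (variation \<mu> A) + \<mu> A) / 2))"

definition jordan_neg :: "('a::topological_space set \<Rightarrow> real) \<Rightarrow> 'a measure" where
  "jordan_neg \<mu> =
     measure_of UNIV (sets borel) (\<lambda>A. ennreal ((enn2real (variation \<mu> A) - \<mu> A) / 2))"

definition signed_integral ::
    "('a::topological_space set \<Rightarrow> real) \<Rightarrow> ('a \<Rightarrow> real) \<Rightarrow> real" where
  "signed_integral \<mu> \<phi> = (\<integral>x. \<phi> x \<partial>jordan_pos \<mu>) - (\<integral>x. \<phi> x \<partial>jordan_neg \<mu>)"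

definition partial_deriv :: "'n::finite \<Rightarrow> (real ^ 'n \<Rightarrow> real) \<Rightarrow> real ^ 'n \<Rightarrow> real" where
  "partial_deriv i \<phi> x = frechet_derivative \<phi> (at x) (axis i 1)"

definition C1_compact_support :: "(real ^ 'n::finite \<Rightarrow> real) set" where
  "C1_compact_support =
     {\<phi>. (\<forall>x. \<phi> differentiable (at x)) \<and>
          (\<forall>i. continuous_on UNIV (partial_deriv i \<phi>)) \<and>
          compact (closure {x. \<phi> x \<noteq> 0})}"

definition has_measure_deriv ::
    "(real ^ 'n::finite \<Rightarrow> real) \<Rightarrow> 'n \<Rightarrow> ((real ^ 'n) set \<Rightarrow> real) \<Rightarrow> bool" where
  "has_measure_deriv g i \<mu> \<longleftrightarrow>
     finite_signed_radon \<mu> \<and>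
     (\<forall>\<phi> \<in> C1_compact_support.
        (\<integral>x. g x * partial_deriv i \<phi> x \<partial>lebesgue) = - signed_integral \<mu> \<phi>)"

text \<open>
  Elements of \<open>L\<^sub>1\<close>, \<open>BV\<close> and \<open>RBV\<close> are given by arbitrary representatives, i.e. the sets
  below are closed under equality almost everywhere.
\<close>

definition BV :: "(real ^ 'n::finite \<Rightarrow> real) set" where
  "BV = {g. integrable lebesgue g \<and> (\<forall>i. \<exists>\<mu>. has_measure_deriv g i \<mu>)}"

text \<open>
  The derivative measure is unique on Borel sets, hence the norm does not depend on the choice.
\<close>

definition bv_deriv :: "(real ^ 'n::finite \<Rightarrow> real) \<Rightarrow> 'n \<Rightarrow> (real ^ 'n) set \<Rightarrow> real" where
  "bv_deriv g i = (SOME \<mu>. has_measure_deriv g i \<mu>)"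

definition bv_norm :: "(real ^ 'n::finite \<Rightarrow> real) \<Rightarrow> real" where
  "bv_norm g = (\<integral>x. \<bar>g x\<bar> \<partial>lebesgue) + (\<Sum>i\<in>UNIV. total_variation (bv_deriv g i))"

text \<open>A class is radial if one of its representatives depends on \<open>|x|\<close> only.\<close>

definition RBV :: "(real ^ 'n::finite \<Rightarrow> real) set" where
  "RBV = {f \<in> BV. \<exists>g. (\<forall>x y. norm x = norm y \<longrightarrow> g x = g y) \<and> (AE x in lebesgue. f x = g x)}"

definition lebesgue_point :: "(real ^ 'n::finite \<Rightarrow> real) \<Rightarrow> real ^ 'n \<Rightarrow> bool" where
  "lebesgue_point f x \<longleftrightarrow>
     ((\<lambda>r. (LINT y:ball x r|lebesgue. \<bar>f y - f x\<bar>) / measure lebesgue (ball x r))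
        \<longlongrightarrow> 0) (at_right 0)"

definition lebesgue_rep :: "(real ^ 'n::finite \<Rightarrow> real) \<Rightarrow> real ^ 'n \<Rightarrow> real" where
  "lebesgue_rep f x = (if lebesgue_point f x then f x else 0)"

end

theory Submission
  imports Defs
begin

text \<open>
  Let \<open>d\<close> be the dimension, \<open>x \<noteq> 0\<close> a Lebesgue point of \<open>f\<close>, \<open>r = |x|\<close>, and test the derivative
  measures with the vector field \<open>y h(|y|)/|y|\<^sup>d\<close>, whose divergence is \<open>h'(|y|)/|y|\<^bsup>d-1\<^esup>\<close>. Here \<open>h\<close>
  rises from 0 to 1 on \<open>[r, r+\<epsilon>]\<close> and falls back to 0 on \<open>[R, 2R]\<close>, so the field is bounded by
  \<open>r\<^bsup>1-d\<^esup>\<close> and supported in \<open>{|y| \<ge> r}\<close>. The falling part contributes at most \<open>O(1/R)\<close> times the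
  \<open>L\<^sub>1\<close> norm. The rising part is a weighted integral of \<open>f\<close> over a shell of width \<open>\<epsilon>\<close>; since \<open>f\<close> is
  radial, the mean deviation of \<open>f\<close> from \<open>f(x)\<close> over the shell is controlled by that over a ball of
  radius \<open>7\<epsilon>\<close> about \<open>x\<close>. Letting \<open>R \<rightarrow> \<infinity>\<close> and \<open>\<epsilon> \<rightarrow> 0\<close> bounds \<open>|x|\<^bsup>d-1\<^esup> |f(x)|\<close> by a constant times
  \<open>\<Sum>\<^sub>i |\<mu>\<^sub>i|({|y| \<ge> |x|})\<close>. This gives both claims, because the tails of a finite measure vanish.
\<close>

section \<open>Rotation invariance of Lebesgue measure\<close>

text \<open>The change of variables theorems of the library need a well-ordered index type, hence the
  detour through the Vitali covering theorem.\<close>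

lemma emeasure_open_le_orthogonal_image:
  fixes T :: "'a::euclidean_space \<Rightarrow> 'a"
  assumes T: "orthogonal_transformation T" and U: "open U"
  shows "emeasure lborel U \<le> emeasure lborel (T ` U)"
proof -
  \<comment> \<open>Balls are indexed by centre and radius. Countably many disjoint members of
    \<open>?K\<close> fill \<open>U\<close> up to a null set, and \<open>T\<close> maps them to
    disjoint balls of the same radii inside the image of \<open>U\<close>.\<close>
  let ?K = "{(a, s). 0 < s \<and> ball a s \<subseteq> U}"
  obtain C where C: "countable C" "C \<subseteq> ?K"
      "pairwise (\<lambda>i j. disjnt (ball (fst i) (snd i)) (ball (fst j) (snd j))) C"
      "negligible (U - (\<Union>i\<in>C. ball (fst i) (snd i)))"
  proof (rule Vitali_covering_theorem_balls[of U ?K fst snd])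
    fix x :: 'a and d :: real
    assume "x \<in> U" "0 < d"
    then obtain e where "0 < e" "ball x e \<subseteq> U" using U by (meson openE)
    then show "\<exists>i. i \<in> ?K \<and> x \<in> ball (fst i) (snd i) \<and> snd i < d"
      using \<open>0 < d\<close> by (intro exI[of _ "(x, min e (d/2))"]) auto
  qed auto
  define D where "D = (\<Union>i\<in>C. ball (fst i) (snd i))"
  have openD: "open D" unfolding D_def by auto
  have disj: "disjoint_family_on (\<lambda>i. ball (fst i) (snd i)) C"
    using C(3) by (auto simp: disjoint_family_on_def pairwise_def disjnt_def)
  have disjT: "disjoint_family_on (\<lambda>i. ball (T (fst i)) (snd i)) C"
    using disj orthogonal_transformation_inj[OF T]
    by (auto simp: disjoint_family_on_def image_orthogonal_transformation_ball[OF T, symmetric]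
        image_Int[symmetric])
  have "U - D \<in> null_sets lborel"
    using C(4) U openD
    by (simp add: D_def negligible_iff_null_sets null_sets_completion_iff)
  then have "emeasure lborel (D \<union> (U - D)) = emeasure lborel D"
    using openD by (intro emeasure_Un_null_set) auto
  moreover have "D \<union> (U - D) = U" using C(2) by (force simp: D_def)
  ultimately have "emeasure lborel U = emeasure lborel D" by simp
  also have "\<dots> = (\<integral>\<^sup>+i. emeasure lborel (ball (fst i) (snd i)) \<partial>count_space C)"
    unfolding D_def using C(1) disj by (intro emeasure_UN_countable) auto
  also have "\<dots> = (\<integral>\<^sup>+i. emeasure lborel (ball (T (fst i)) (snd i)) \<partial>count_space C)"
    using C(2) by (intro nn_integral_cong) (auto simp: emeasure_ball)
  also have "\<dots> = emeasure lborel (\<Union>i\<in>C. ball (T (fst i)) (snd i))"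
    using C(1) disjT by (intro emeasure_UN_countable[symmetric]) auto
  also have "\<dots> \<le> emeasure lborel (T ` U)"
  proof (rule emeasure_mono)
    show "(\<Union>i\<in>C. ball (T (fst i)) (snd i)) \<subseteq> T ` U"
      using C(2) by (force simp: image_orthogonal_transformation_ball[OF T, symmetric])
    show "T ` U \<in> sets lborel"
    proof -
      have "T ` U = inv T -` U"
        using bij_vimage_eq_inv_image[OF bij_imp_bij_inv[OF orthogonal_transformation_bij[OF T]]]
        by (simp add: inv_inv_eq orthogonal_transformation_bij[OF T])
      moreover have "open (inv T -` U)"
        using T U by (intro open_vimage linear_continuous_on linear_conv_bounded_linear[THEN iffD1]
            orthogonal_transformation_linear orthogonal_transformation_inv)
      ultimately show ?thesis by simp
    qed
  qed
  finally show ?thesis .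
qed

text \<open>The previous inequality, used for \<open>T\<close> on the preimage of a box and for
  \<open>inv T\<close> on the box itself, gives equality on boxes, and these determine
  \<open>lborel\<close>.\<close>

lemma distr_lborel_orthogonal_transformation:
  fixes T :: "'a::euclidean_space \<Rightarrow> 'a"
  assumes T: "orthogonal_transformation T"
  shows "distr lborel borel T = lborel"
proof (rule lborel_eqI[symmetric])
  fix l u :: 'a
  assume "\<And>b. b \<in> Basis \<Longrightarrow> l \<bullet> b \<le> u \<bullet> b"
  have bij: "bij T" using T by (rule orthogonal_transformation_bij)
  have meas: "T \<in> borel_measurable borel"
    using T by (intro borel_measurable_continuous_onI linear_continuous_on
      linear_conv_bounded_linear[THEN iffD1] orthogonal_transformation_linear)
  have vim: "T -` box l u = inv T ` box l u"
    using bij by (simp add: bij_vimage_eq_inv_image)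
  have "open (T -` box l u)"
    using T by (intro open_vimage open_box linear_continuous_on
      linear_conv_bounded_linear[THEN iffD1] orthogonal_transformation_linear)
  then have "emeasure lborel (T -` box l u) \<le> emeasure lborel (T ` (T -` box l u))"
    by (rule emeasure_open_le_orthogonal_image[OF T])
  also have "T ` (T -` box l u) = box l u"
    using bij by (simp add: bij_is_surj surj_image_vimage_eq)
  finally have "emeasure lborel (T -` box l u) \<le> emeasure lborel (box l u)" .
  moreover have "emeasure lborel (box l u) \<le> emeasure lborel (T -` box l u)"
    unfolding vim
    by (intro emeasure_open_le_orthogonal_image orthogonal_transformation_inv T open_box)
  ultimately have "emeasure lborel (T -` box l u) = emeasure lborel (box l u)" by simp
  then show "emeasure (distr lborel borel T) (box l u) = (\<Prod>b\<in>Basis. (u - l) \<bullet> b)"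
    using meas \<open>\<And>b. b \<in> Basis \<Longrightarrow> l \<bullet> b \<le> u \<bullet> b\<close>
    by (simp add: emeasure_distr emeasure_lborel_box)
qed simp

section \<open>Thin shells\<close>

text \<open>In the factorization \<open>a ^ n - b ^ n = (a - b) * (\<Sum>p<n. a ^ p * b ^ (n - 1 -
  p))\<close> every summand lies between \<open>b ^ (n - 1)\<close> and \<open>a ^ (n - 1)\<close>.
  Together with \<open>power_diff_ge\<close> this controls volumes of thin shells to first order in
  their width.\<close>

lemma power_diff_le:
  fixes a b :: real
  assumes "0 \<le> b" "b \<le> a"
  shows "a ^ n - b ^ n \<le> real n * a ^ (n - 1) * (a - b)"
proof (cases n)
  case (Suc k)
  have "(\<Sum>p<Suc k. a ^ p * b ^ (k - p)) \<le> (\<Sum>p<Suc k. a ^ k)"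
  proof (rule sum_mono)
    fix p assume "p \<in> {..<Suc k}"
    then have "a ^ p * b ^ (k - p) \<le> a ^ p * a ^ (k - p)" "p \<le> k"
      using assms by (auto intro!: mult_left_mono power_mono)
    then show "a ^ p * b ^ (k - p) \<le> a ^ k" by (simp add: power_add[symmetric])
  qed
  then have "(a - b) * (\<Sum>p<Suc k. a ^ p * b ^ (k - p)) \<le> (a - b) * (\<Sum>p<Suc k. a ^ k)"
    using assms by (intro mult_left_mono) auto
  then show ?thesis
    by (simp add: Suc diff_power_eq_sum mult_ac del: sum.lessThan_Suc power_Suc)
qed simp

lemma power_diff_ge:
  fixes a b :: real
  assumes "0 \<le> b" "b \<le> a"
  shows "real n * b ^ (n - 1) * (a - b) \<le> a ^ n - b ^ n"
proof (cases n)
  case (Suc k)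
  have "(\<Sum>p<Suc k. b ^ k) \<le> (\<Sum>p<Suc k. a ^ p * b ^ (k - p))"
  proof (rule sum_mono)
    fix p assume "p \<in> {..<Suc k}"
    then have "b ^ p * b ^ (k - p) \<le> a ^ p * b ^ (k - p)" "p \<le> k"
      using assms by (auto intro!: mult_right_mono power_mono)
    then show "b ^ k \<le> a ^ p * b ^ (k - p)" by (simp add: power_add[symmetric])
  qed
  then have "(a - b) * (\<Sum>p<Suc k. b ^ k) \<le> (a - b) * (\<Sum>p<Suc k. a ^ p * b ^ (k - p))"
    using assms by (intro mult_left_mono) auto
  then show ?thesis
    by (simp add: Suc diff_power_eq_sum mult_ac del: sum.lessThan_Suc power_Suc)
qed simp

text \<open>By the Vitali covering lemma, disjoint balls of radius \<epsilon> centred on the sphere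
  cover it once enlarged fivefold. The small balls lie between the radii r - \<epsilon> and r +
  \<epsilon>, so comparing volumes bounds their number.\<close>

lemma sphere_cover:
  fixes r \<epsilon> :: real
  assumes "0 < \<epsilon>" "\<epsilon> \<le> r"
  obtains C :: "'a::euclidean_space set" where "finite C" "C \<subseteq> sphere 0 r"
    "sphere 0 r \<subseteq> (\<Union>z\<in>C. cball z (5 * \<epsilon>))"
    "real (card C) * \<epsilon> ^ DIM('a) \<le> (r + \<epsilon>) ^ DIM('a) - (r - \<epsilon>) ^ DIM('a)"
proof -
  let ?d = "DIM('a)" and ?\<beta> = "unit_ball_vol (DIM('a))"
  obtain C :: "'a set" where C: "countable C" "C \<subseteq> sphere 0 r"
      "pairwise (\<lambda>i j. disjnt (cball i \<epsilon>) (cball j \<epsilon>)) C"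
      "sphere 0 r \<subseteq> (\<Union>z\<in>C. cball z (5 * \<epsilon>))"
    by (rule Vitali_covering_lemma_cballs[where S = "sphere (0::'a) r" and K = "sphere 0 r"
          and a = "\<lambda>z. z" and r = "\<lambda>_. \<epsilon>" and B = \<epsilon>])
       (use assms in auto)
  \<comment> \<open>The count is first bounded for finite subfamilies; since the bound is uniform,
    \<open>C\<close> itself is then finite.\<close>
  have bd: "real (card G) * \<epsilon> ^ ?d \<le> (r + \<epsilon>) ^ ?d - (r - \<epsilon>) ^ ?d" if G: "G \<subseteq> C" "finite G" for G
  proof -
    have "disjoint_family_on (\<lambda>z. cball z \<epsilon>) G"
      using C(3) G by (auto simp: disjoint_family_on_def pairwise_def disjnt_def subset_iff)
    then have "measure lborel (\<Union>z\<in>G. cball z \<epsilon>) = (\<Sum>z\<in>G. measure lborel (cball z \<epsilon>))"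
      using G by (intro measure_finite_Union) (auto simp: emeasure_lborel_cball_finite less_top[symmetric] emeasure_cball assms less_imp_le)
    also have "\<dots> = real (card G) * (?\<beta> * \<epsilon> ^ ?d)"
      using assms by (simp add: content_cball)
    finally have 1: "measure lborel (\<Union>z\<in>G. cball z \<epsilon>) = real (card G) * (?\<beta> * \<epsilon> ^ ?d)" .
    \<comment> \<open>With the inner ball adjoined, the disjoint small balls still fit into one
      large ball, so only volumes of balls are compared.\<close>
    have "(\<Union>z\<in>G. cball z \<epsilon>) \<inter> ball 0 (r - \<epsilon>) = {}"
    proof -
      have "False" if "z \<in> G" "dist z y \<le> \<epsilon>" "norm y < r - \<epsilon>" for z y
        using that G C(2) norm_triangle_ineq[of "z - y" y] by (auto simp: dist_norm subset_iff)
      then show ?thesis by force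
    qed
    then have "measure lborel (\<Union>z\<in>G. cball z \<epsilon>) + measure lborel (ball (0::'a) (r - \<epsilon>))
       = measure lborel ((\<Union>z\<in>G. cball z \<epsilon>) \<union> ball 0 (r - \<epsilon>))"
    proof (intro measure_Union[symmetric])
      show "emeasure lborel (\<Union>z\<in>G. cball z \<epsilon>) \<noteq> \<infinity>"
        using G emeasure_bounded_finite[of "\<Union>z\<in>G. cball z \<epsilon>"] by (simp add: bounded_UN)
    qed (use G assms in \<open>auto simp: emeasure_ball\<close>)
    also have "\<dots> \<le> measure lborel (cball (0::'a) (r + \<epsilon>))"
    proof (rule measure_mono_fmeasurable)
      have "norm y \<le> r + \<epsilon>" if "z \<in> G" "dist z y \<le> \<epsilon>" for z y
        using that G C(2) norm_triangle_ineq[of "y - z" z] by (auto simp: dist_norm subset_iff norm_minus_commute)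
      then show "(\<Union>z\<in>G. cball z \<epsilon>) \<union> ball 0 (r - \<epsilon>) \<subseteq> cball 0 (r + \<epsilon>)"
        using assms by auto
      have "(\<Union>z\<in>G. cball z \<epsilon>) \<in> sets lborel"
        using G by (auto intro!: borel_closed closed_UN)
      then show "(\<Union>z\<in>G. cball z \<epsilon>) \<union> ball 0 (r - \<epsilon>) \<in> sets lborel" by auto
      show "cball (0::'a) (r + \<epsilon>) \<in> fmeasurable lborel" by (intro fmeasurable_compact compact_cball)
    qed
    finally have "?\<beta> * (real (card G) * \<epsilon> ^ ?d) \<le> ?\<beta> * ((r + \<epsilon>) ^ ?d - (r - \<epsilon>) ^ ?d)"
      using assms by (simp add: 1 content_cball content_ball algebra_simps)
    then show ?thesis by (simp add: mult_le_cancel_left)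
  qed
  have "finite C"
  proof -
    let ?N = "nat \<lceil>((r + \<epsilon>) ^ ?d - (r - \<epsilon>) ^ ?d) / \<epsilon> ^ ?d\<rceil>"
    have "card G \<le> ?N" if "G \<subseteq> C" "finite G" for G
    proof -
      have "real (card G) \<le> ((r + \<epsilon>) ^ ?d - (r - \<epsilon>) ^ ?d) / \<epsilon> ^ ?d"
        using bd[OF that] assms by (simp add: pos_le_divide_eq)
      then show ?thesis by linarith
    qed
    then show ?thesis using finite_if_finite_subsets_card_bdd by blast
  qed
  with C bd show ?thesis by (intro that[of C]) auto
qed

text \<open>The shell is covered by rotated copies of a single ball, whose number is bounded by
  \<open>sphere_cover\<close>. This replaces integration in polar coordinates.\<close>

lemma shell_integral_le_ball_integral:
  fixes F :: "real ^ 'n::finite \<Rightarrow> real"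
  assumes [measurable]: "F \<in> borel_measurable borel" and F0: "\<And>y. 0 \<le> F y"
    and inv: "\<And>T. orthogonal_transformation T \<Longrightarrow> AE y in lborel. F (T y) = F y"
    and int: "\<And>z s. integrable lborel (\<lambda>y. indicator (ball z s) y * F y)"
    and x: "norm x = r" and \<epsilon>: "0 < \<epsilon>" "\<epsilon> \<le> r"
  shows "\<epsilon> ^ CARD('n) * (\<integral>y. indicator {y. r < norm y \<and> norm y < r + \<epsilon>} y * F y \<partial>lborel)
     \<le> ((r + \<epsilon>) ^ CARD('n) - (r - \<epsilon>) ^ CARD('n)) * (\<integral>y. indicator (ball x (7 * \<epsilon>)) y * F y \<partial>lborel)"
proof -
  let ?S = "{y::real^'n. r < norm y \<and> norm y < r + \<epsilon>}"
  let ?I = "\<lambda>z. \<integral>y. indicator (ball z (7 * \<epsilon>)) y * F y \<partial>lborel"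
  obtain C :: "(real^'n) set" where C: "finite C" "C \<subseteq> sphere 0 r"
    "sphere 0 r \<subseteq> (\<Union>z\<in>C. cball z (5 * \<epsilon>))"
    "real (card C) * \<epsilon> ^ CARD('n) \<le> (r + \<epsilon>) ^ CARD('n) - (r - \<epsilon>) ^ CARD('n)"
    using sphere_cover[OF \<epsilon>, where 'a = "real^'n"] by auto
  \<comment> \<open>Every ball of the cover gives the same integral: a rotation takes
    \<open>x\<close> to \<open>z\<close>, and \<open>F\<close> is invariant under it almost
    everywhere.\<close>
  have I: "?I z = ?I x" if "z \<in> C" for z
  proof -
    have "norm x = norm z" using that C(2) x by auto
    then obtain T where T: "orthogonal_transformation T" "T x = z"
      using orthogonal_transformation_exists by blast
    have [measurable]: "T \<in> borel_measurable borel"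
      using T by (intro borel_measurable_continuous_onI linear_continuous_on
        linear_conv_bounded_linear[THEN iffD1] orthogonal_transformation_linear)
    have "T y \<in> ball z (7 * \<epsilon>) \<longleftrightarrow> y \<in> ball x (7 * \<epsilon>)" for y
      using T by (auto simp: orthogonal_transformation_isometry)
    then have ind: "indicator (ball z (7 * \<epsilon>)) (T y) = (indicator (ball x (7 * \<epsilon>)) y :: real)" for y
      by (simp add: indicator_def)
    have "?I z = (\<integral>y. indicator (ball z (7 * \<epsilon>)) y * F y \<partial>distr lborel borel T)"
      by (simp add: distr_lborel_orthogonal_transformation[OF T(1)])
    also have "\<dots> = (\<integral>y. indicator (ball x (7 * \<epsilon>)) y * F (T y) \<partial>lborel)"
      by (subst integral_distr) (auto simp: ind intro!: borel_measurable_times borel_measurable_indicator)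
    also have "\<dots> = ?I x"
      using inv[OF T(1)]
      by (intro integral_cong_AE) (auto intro!: borel_measurable_times borel_measurable_indicator)
    finally show ?thesis .
  qed
  have "(\<integral>y. indicator ?S y * F y \<partial>lborel)
      \<le> (\<integral>y. (\<Sum>z\<in>C. indicator (ball z (7 * \<epsilon>)) y * F y) \<partial>lborel)"
  proof (rule integral_mono')
    show "integrable lborel (\<lambda>y. \<Sum>z\<in>C. indicator (ball z (7 * \<epsilon>)) y * F y)"
      using int by auto
    fix y :: "real^'n"
    show "0 \<le> (\<Sum>z\<in>C. indicator (ball z (7 * \<epsilon>)) y * F y)"
      using F0 by (auto intro!: sum_nonneg)
    show "indicator ?S y * F y \<le> (\<Sum>z\<in>C. indicator (ball z (7 * \<epsilon>)) y * F y)"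
    proof (cases "y \<in> ?S")
      case True
      \<comment> \<open>The radial projection of \<open>y\<close> onto the sphere is within
        \<epsilon> of \<open>y\<close> and within 5 \<epsilon> of some centre, so \<open>y\<close>
        is less than 6 \<epsilon> from that centre; radius 7 \<epsilon> suffices.\<close>
      define p where "p = (r / norm y) *\<^sub>R y"
      have y0: "norm y > 0" using True \<epsilon> by auto
      have "norm p = r" using True \<epsilon> y0 by (simp add: p_def)
      then obtain z where z: "z \<in> C" "dist z p \<le> 5 * \<epsilon>" using C(3) by force
      have "p - y = (r / norm y - 1) *\<^sub>R y" by (simp add: p_def algebra_simps)
      then have "dist p y = \<bar>r / norm y - 1\<bar> * norm y" by (simp add: dist_norm)
      also have "\<dots> = \<bar>(r / norm y - 1) * norm y\<bar>" by (simp add: abs_mult)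
      also have "(r / norm y - 1) * norm y = r - norm y" using y0 by (simp add: field_simps)
      finally have "dist p y < \<epsilon>" using True by auto
      then have "y \<in> ball z (7 * \<epsilon>)"
        using z(2) dist_triangle[of z y p] \<epsilon> by auto
      then have "indicator ?S y * F y = indicator (ball z (7 * \<epsilon>)) y * F y" using True by simp
      also have "\<dots> \<le> (\<Sum>z\<in>C. indicator (ball z (7 * \<epsilon>)) y * F y)"
        using z(1) C(1) F0 by (intro member_le_sum) auto
      finally show ?thesis .
    qed (use F0 in \<open>auto intro!: sum_nonneg\<close>)
  qed
  also have "\<dots> = (\<Sum>z\<in>C. ?I z)" using int by (intro Bochner_Integration.integral_sum) auto
  also have "\<dots> = real (card C) * ?I x" using I by simp
  finally have "\<epsilon> ^ CARD('n) * (\<integral>y. indicator ?S y * F y \<partial>lborel)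
      \<le> \<epsilon> ^ CARD('n) * (real (card C) * ?I x)"
    using \<epsilon> by (intro mult_left_mono) auto
  also have "\<dots> = (real (card C) * \<epsilon> ^ CARD('n)) * ?I x" by simp
  also have "\<dots> \<le> ((r + \<epsilon>) ^ CARD('n) - (r - \<epsilon>) ^ CARD('n)) * ?I x"
    using C(4) F0 by (intro mult_right_mono) (auto intro!: integral_nonneg_AE)
  finally show ?thesis .
qed

section \<open>Variation of signed measures\<close>

text \<open>A partition of \<open>A\<close> becomes one of \<open>B\<close> by putting
  \<open>B - A\<close> in front, which can only increase the sum.\<close>

lemma variation_mono:
  assumes "\<mu> {} = 0" "A \<subseteq> B" "A \<in> sets borel" "B \<in> sets borel"
  shows "variation \<mu> A \<le> variation \<mu> B"
  unfolding variation_def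
proof (rule SUP_least)
  fix E :: "nat \<Rightarrow> 'a set"
  assume E: "E \<in> {E. range E \<subseteq> sets borel \<and> disjoint_family E \<and> (\<Union>i. E i) = A}"
  define E' where "E' = (\<lambda>i. case i of 0 \<Rightarrow> B - A | Suc j \<Rightarrow> E j)"
  have disj: "disjoint_family E'"
    unfolding disjoint_family_on_def
  proof (intro ballI impI)
    fix m n :: nat assume "m \<noteq> n"
    then show "E' m \<inter> E' n = {}"
      using E by (cases m; cases n) (auto simp: E'_def disjoint_family_on_def)
  qed
  have un: "(\<Union>i. E' i) = B"
  proof
    show "(\<Union>i. E' i) \<subseteq> B" using E assms(2) by (fastforce simp: E'_def split: nat.splits)
    show "B \<subseteq> (\<Union>i. E' i)"
    proof
      fix x assume "x \<in> B"
      moreover have "x \<in> E' 0" if "x \<in> B" "x \<notin> A" using that by (simp add: E'_def)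
      moreover have "\<exists>j. x \<in> E' (Suc j)" if "x \<in> A" using that E by (auto simp: E'_def)
      ultimately show "x \<in> (\<Union>i. E' i)" by blast
    qed
  qed
  have sets: "range E' \<subseteq> sets borel"
    using E assms by (auto simp: E'_def split: nat.splits)
  have "(\<Sum>i. ennreal \<bar>\<mu> (E i)\<bar>) \<le> (\<Sum>i. ennreal \<bar>\<mu> (E' i)\<bar>)"
  proof (rule suminf_le_const)
    fix n
    have "(\<Sum>i<n. ennreal \<bar>\<mu> (E i)\<bar>) = (\<Sum>i\<in>Suc ` {..<n}. ennreal \<bar>\<mu> (E' i)\<bar>)"
      by (simp add: sum.reindex E'_def)
    also have "\<dots> \<le> (\<Sum>i. ennreal \<bar>\<mu> (E' i)\<bar>)" by (intro sum_le_suminf) auto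
    finally show "(\<Sum>i<n. ennreal \<bar>\<mu> (E i)\<bar>) \<le> (\<Sum>i. ennreal \<bar>\<mu> (E' i)\<bar>)" .
  qed simp
  also have "\<dots> \<le> (SUP E \<in> {E. range E \<subseteq> sets borel \<and> disjoint_family E \<and> (\<Union>i. E i) = B}.
      \<Sum>i. ennreal \<bar>\<mu> (E i)\<bar>)"
    using disj un sets by (intro SUP_upper) auto
  finally show "(\<Sum>i. ennreal \<bar>\<mu> (E i)\<bar>) \<le> (SUP E \<in> {E. range E \<subseteq> sets borel \<and> disjoint_family E \<and> (\<Union>i. E i) = B}.
      \<Sum>i. ennreal \<bar>\<mu> (E i)\<bar>)" .
qed

text \<open>The partition \<open>A\<close>, \<open>{}\<close>, \<open>{}\<close>, ... attains the
  bound. It makes both Jordan set functions nonnegative.\<close>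

lemma abs_le_variation:
  assumes "\<mu> {} = 0" "A \<in> sets borel"
  shows "ennreal \<bar>\<mu> A\<bar> \<le> variation \<mu> A"
proof -
  let ?E = "\<lambda>i::nat. if i = 0 then A else {}"
  have "ennreal \<bar>\<mu> A\<bar> = (\<Sum>i\<in>{0::nat}. ennreal \<bar>\<mu> (?E i)\<bar>)" by simp
  also have "\<dots> = (\<Sum>i. ennreal \<bar>\<mu> (?E i)\<bar>)"
    using assms by (intro suminf_finite[symmetric]) auto
  also have "\<dots> \<le> variation \<mu> A"
    unfolding variation_def using assms
    by (intro SUP_upper) (auto simp: disjoint_family_on_def)
  finally show ?thesis .
qed

lemma sets_measure_of_borel:
  "sets (measure_of UNIV (sets (borel :: 'a::topological_space measure)) m) = sets borel"
  using sets.sigma_sets_eq[of "borel :: 'a measure"] by (simp add: sets_measure_of_conv)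

text \<open>\<open>measure_of\<close> yields either the value of the given set function or the
  default 0, and both are at most \<open>m A\<close>.\<close>

lemma emeasure_measure_of_borel_le:
  "emeasure (measure_of UNIV (sets borel) m) A \<le> m A"
  by (simp add: emeasure_measure_of_conv)

lemma abs_integral_le_of_support:
  fixes \<phi> :: "'a \<Rightarrow> real"
  assumes A: "A \<in> sets N" and m: "emeasure N A \<le> ennreal v" and "0 \<le> v" "0 \<le> C"
    and \<phi>: "\<And>x. \<bar>\<phi> x\<bar> \<le> C * indicator A x"
  shows "\<bar>\<integral>x. \<phi> x \<partial>N\<bar> \<le> C * v"
proof -
  have fin: "emeasure N A < \<infinity>" using m by (auto intro: le_less_trans)
  have "\<bar>\<integral>x. \<phi> x \<partial>N\<bar> \<le> (\<integral>x. \<bar>\<phi> x\<bar> \<partial>N)" by (rule integral_abs_bound)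
  \<comment> \<open>\<open>integral_mono'\<close> asks for integrability of the majorant; a
    nonintegrable left integrand has integral 0 by default.\<close>
  also have "\<dots> \<le> (\<integral>x. C * indicator A x \<partial>N)"
    using assms fin by (intro integral_mono') auto
  also have "\<dots> = C * measure N A" using A fin by simp
  also have "measure N A \<le> v" using m \<open>0 \<le> v\<close> by (simp add: measure_def enn2real_leI)
  finally show ?thesis using \<open>0 \<le> C\<close> by (simp add: mult_left_mono)
qed

text \<open>Only the upper bound \<open>emeasure_measure_of_borel_le\<close> for the Jordan parts is needed, so the
  countable additivity of the variation plays no role.\<close>

lemma abs_signed_integral_le:
  assumes \<mu>: "finite_signed_radon \<mu>" and A: "A \<in> sets borel" and "0 \<le> C"
    and \<phi>: "\<And>x. \<bar>\<phi> x\<bar> \<le> C * indicator A x"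
  shows "\<bar>signed_integral \<mu> \<phi>\<bar> \<le> C * enn2real (variation \<mu> A)"
proof -
  let ?V = "enn2real (variation \<mu> A)"
  have "variation \<mu> A \<le> variation \<mu> UNIV"
    using \<mu> A by (intro variation_mono) (auto simp: finite_signed_radon_def)
  then have fin: "variation \<mu> A < \<infinity>" using \<mu> by (auto simp: finite_signed_radon_def)
  have "ennreal \<bar>\<mu> A\<bar> \<le> ennreal ?V"
    using abs_le_variation[of \<mu> A] \<mu> A fin by (simp add: finite_signed_radon_def)
  then have V: "\<bar>\<mu> A\<bar> \<le> ?V" by (simp add: ennreal_le_iff)
  \<comment> \<open>The two Jordan parts give \<open>A\<close> at most the masses
    \<open>(?V + \<mu> A) / 2\<close> and \<open>(?V - \<mu> A) / 2\<close>; in their sum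
    \<open>\<mu> A\<close> cancels.\<close>
  have "\<bar>\<integral>x. \<phi> x \<partial>jordan_pos \<mu>\<bar> \<le> C * ((?V + \<mu> A) / 2)"
  proof (rule abs_integral_le_of_support[OF _ _ _ \<open>0 \<le> C\<close> \<phi>])
    show "emeasure (jordan_pos \<mu>) A \<le> ennreal ((?V + \<mu> A) / 2)"
      unfolding jordan_pos_def by (rule emeasure_measure_of_borel_le)
    show "A \<in> sets (jordan_pos \<mu>)"
      using A by (simp add: jordan_pos_def sets_measure_of_borel)
    show "0 \<le> (?V + \<mu> A) / 2" using V by simp
  qed
  moreover have "\<bar>\<integral>x. \<phi> x \<partial>jordan_neg \<mu>\<bar> \<le> C * ((?V - \<mu> A) / 2)"
  proof (rule abs_integral_le_of_support[OF _ _ _ \<open>0 \<le> C\<close> \<phi>])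
    show "emeasure (jordan_neg \<mu>) A \<le> ennreal ((?V - \<mu> A) / 2)"
      unfolding jordan_neg_def by (rule emeasure_measure_of_borel_le)
    show "A \<in> sets (jordan_neg \<mu>)"
      using A by (simp add: jordan_neg_def sets_measure_of_borel)
    show "0 \<le> (?V - \<mu> A) / 2" using V by simp
  qed
  moreover have "C * ((?V + \<mu> A) / 2) + C * ((?V - \<mu> A) / 2) = C * ?V" by (simp add: field_simps)
  ultimately show ?thesis unfolding signed_integral_def by linarith
qed

text \<open>The compact approximation clause of \<open>finite_signed_radon\<close>, applied to the
  whole space, gives a compact set whose complement has small variation and contains all far
  tails.\<close>

lemma variation_tail_tendsto_0:
  fixes \<mu> :: "'a::euclidean_space set \<Rightarrow> real"
  assumes \<mu>: "finite_signed_radon \<mu>"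
  shows "((\<lambda>r. enn2real (variation \<mu> {x. r \<le> norm x})) \<longlongrightarrow> 0) at_top"
proof (rule order_tendstoI)
  fix e :: real assume "0 < e"
  then obtain K where K: "compact K" "variation \<mu> (UNIV - K) < ennreal e"
    using \<mu> unfolding finite_signed_radon_def by (metis sets.top space_borel)
  obtain R where R: "\<And>x. x \<in> K \<Longrightarrow> norm x \<le> R"
    using compact_imp_bounded[OF K(1)] by (auto simp: bounded_iff)
  have "enn2real (variation \<mu> {x. r \<le> norm x}) < e" if "r > R" for r
  proof -
    have "{x. r \<le> norm x} \<subseteq> UNIV - K" using R that by force
    then have "variation \<mu> {x. r \<le> norm x} \<le> variation \<mu> (UNIV - K)"
      using \<mu> K(1) by (intro variation_mono) (auto simp: finite_signed_radon_def compact_imp_closed)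
    then have "variation \<mu> {x. r \<le> norm x} < ennreal e" using K(2) by simp
    then show ?thesis using \<open>0 < e\<close> by (cases rule: ennreal_cases[of "variation \<mu> {x. r \<le> norm x}"]) (auto simp: ennreal_less_iff)
  qed
  then show "\<forall>\<^sub>F r in at_top. enn2real (variation \<mu> {x. r \<le> norm x}) < e"
    using eventually_gt_at_top[of R] by (rule eventually_mono[rotated])
next
  fix e :: real assume "e < 0"
  then show "\<forall>\<^sub>F r in at_top. e < enn2real (variation \<mu> {x. r \<le> norm x})"
    by (simp add: order_less_le_trans)
qed

section \<open>Radial test fields\<close>

text \<open>The square removes the kink of the positive part: at 0 the difference quotient is
  bounded by the absolute value of the increment.\<close>

lemma has_real_derivative_max_0_power2:
  "((\<lambda>t. (max 0 t)\<^sup>2) has_real_derivative 2 * max 0 t) (at t)"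
proof -
  consider "t < 0" | "t > 0" | "t = 0" by linarith
  then show ?thesis
  proof cases
    case 1
    have "((\<lambda>t. 0) has_real_derivative 2 * max 0 t) (at t)" using 1 by simp
    then show ?thesis
      by (rule has_field_derivative_transform_within_open[where S = "{..<0}"]) (use 1 in auto)
  next
    case 2
    have "((\<lambda>t. t\<^sup>2) has_real_derivative 2 * max 0 t) (at t)"
      using 2 by (auto intro!: derivative_eq_intros)
    then show ?thesis
      by (rule has_field_derivative_transform_within_open[where S = "{0<..}"]) (use 2 in auto)
  next
    case 3
    have "((\<lambda>h. (max 0 h)\<^sup>2 / h) \<longlongrightarrow> 0) (at (0::real))"
    proof (rule Lim_null_comparison)
      have "norm ((max 0 h)\<^sup>2 / h) \<le> \<bar>h\<bar>" for h :: real
        by (cases "h > 0") (auto simp: max_def power2_eq_square)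
      then show "\<forall>\<^sub>F h in at (0::real). norm ((max 0 h)\<^sup>2 / h) \<le> \<bar>h\<bar>" by simp
      show "((\<lambda>h. \<bar>h\<bar>) \<longlongrightarrow> 0) (at (0::real))" by (intro tendsto_rabs_zero tendsto_ident_at)
    qed
    then show ?thesis by (simp add: 3 has_field_derivative_iff)
  qed
qed

text \<open>A quadratic spline with knots 0, 1/2 and 1 that climbs from 0 to 1. Test functions need
  only be continuously differentiable, so a spline suffices.\<close>

definition ramp :: "real \<Rightarrow> real" where
  "ramp t = 2 * ((max 0 t)\<^sup>2 - 2 * (max 0 (t - 1/2))\<^sup>2 + (max 0 (t - 1))\<^sup>2)"

text \<open>The hat function on [0, 1] with peak 2 at 1/2 and integral 1; it is the derivative of
  \<open>ramp\<close>.\<close>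

definition tent :: "real \<Rightarrow> real" where
  "tent t = 4 * (max 0 t - 2 * max 0 (t - 1/2) + max 0 (t - 1))"

lemma has_real_derivative_ramp: "(ramp has_real_derivative tent t) (at t)"
proof -
  have "((\<lambda>t. (max 0 (t - a))\<^sup>2) has_real_derivative 2 * max 0 (t - a)) (at t)" for a
    using DERIV_shift[of "\<lambda>t. (max 0 t)\<^sup>2" "2 * max 0 (t - a)" t "- a"]
      has_real_derivative_max_0_power2[of "t - a"] by simp
  from this[of 0] this[of "1/2"] this[of 1]
  have "((\<lambda>t. 2 * ((max 0 t)\<^sup>2 - 2 * (max 0 (t - 1/2))\<^sup>2 + (max 0 (t - 1))\<^sup>2)) has_real_derivative
      2 * (2 * max 0 t - 2 * (2 * max 0 (t - 1/2)) + 2 * max 0 (t - 1))) (at t)"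
    by (intro DERIV_cmult DERIV_add DERIV_diff) auto
  then show ?thesis by (simp add: ramp_def[abs_def] tent_def algebra_simps)
qed

lemma continuous_tent: "continuous_on A tent"
  unfolding tent_def by (intro continuous_intros)

lemma tent_bounds: "0 \<le> tent t" "tent t \<le> 2"
  by (auto simp: tent_def max_def)

lemma tent_eq_0: "t \<le> 0 \<or> 1 \<le> t \<Longrightarrow> tent t = 0"
  by (auto simp: tent_def max_def)

lemma tent_ge_1: "1/4 \<le> t \<Longrightarrow> t \<le> 3/4 \<Longrightarrow> 1 \<le> tent t"
  by (auto simp: tent_def max_def)

lemma ramp_eq_0: "t \<le> 0 \<Longrightarrow> ramp t = 0"
  by (auto simp: ramp_def max_def)

lemma ramp_eq_1: "1 \<le> t \<Longrightarrow> ramp t = 1"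
  by (auto simp: ramp_def max_def power2_eq_square algebra_simps)

lemma ramp_bounds: "0 \<le> ramp t" "ramp t \<le> 1"
proof -
  have mono: "ramp s \<le> ramp t" if "s \<le> t" for s t
    by (rule DERIV_nonneg_imp_nondecreasing[OF that]) (use has_real_derivative_ramp tent_bounds(1) in blast)
  show "0 \<le> ramp t" using mono[of "min t 0" t] ramp_eq_0[of "min t 0"] by simp
  show "ramp t \<le> 1" using mono[of t "max t 1"] ramp_eq_1[of "max t 1"] by simp
qed

lemma integrable_mult_bounded:
  fixes f g :: "'a \<Rightarrow> real"
  assumes f: "integrable M f" and [measurable]: "g \<in> borel_measurable M" and B: "\<And>x. \<bar>g x\<bar> \<le> B"
  shows "integrable M (\<lambda>x. f x * g x)"
proof (rule Bochner_Integration.integrable_bound[of M "\<lambda>x. B * f x"])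
  have [measurable]: "f \<in> borel_measurable M" using f by simp
  show "(\<lambda>x. f x * g x) \<in> borel_measurable M" by measurable
  have "norm (f x * g x) \<le> norm (B * f x)" for x
    using mult_right_mono[OF order_trans[OF B[of x] abs_ge_self[of B]], of "\<bar>f x\<bar>"]
    by (simp add: abs_mult mult.commute)
  then show "AE x in M. norm (f x * g x) \<le> norm (B * f x)" by simp
qed (use f in simp)

section \<open>Vector fields x k(|x|) with a profile vanishing near the origin and far away\<close>

context
  fixes k m :: "real \<Rightarrow> real" and a b :: real
  assumes a: "0 < a"
    and k: "\<And>s. 0 < s \<Longrightarrow> (k has_real_derivative s * m s) (at s)"
    and m: "continuous_on UNIV m"
    and zero: "\<And>s. s \<le> a \<Longrightarrow> k s = 0" "\<And>s. s \<le> a \<Longrightarrow> m s = 0" "\<And>s. b \<le> s \<Longrightarrow> k s = 0"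
begin

text \<open>With the derivative of \<open>k\<close> written as \<open>s * m s\<close>, the gradient
  of k(|x|) is m(|x|) x, without a division by |x|. The norm is not differentiable at the origin,
  but there the field is locally 0.\<close>

lemma has_derivative_radial_field:
  fixes x :: "real ^ 'n::finite"
  shows "((\<lambda>x. x $ i * k (norm x)) has_derivative
      (\<lambda>h. h $ i * k (norm x) + x $ i * (m (norm x) * (x \<bullet> h)))) (at x)"
proof (cases "x = 0")
  case True
  have "((\<lambda>x::real^'n. 0) has_derivative (\<lambda>h. h $ i * k (norm x) + x $ i * (m (norm x) * (x \<bullet> h)))) (at x)"
    using True a by (simp add: zero)
  then show ?thesis
    by (rule has_derivative_transform_within_open[where s = "ball 0 a"])
       (use True a zero in auto)
next
  case False
  have "(norm has_derivative (\<lambda>h. h \<bullet> sgn x)) (at x)"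
    using has_derivative_norm[OF False] by (simp add: inner_commute)
  then have "((\<lambda>x. k (norm x)) has_derivative (\<lambda>h. (h \<bullet> sgn x) * (norm x * m (norm x)))) (at x)"
    using False by (intro DERIV_compose_FDERIV k) auto
  then have "((\<lambda>x. x $ i * k (norm x)) has_derivative
      (\<lambda>h. x $ i * ((h \<bullet> sgn x) * (norm x * m (norm x))) + h $ i * k (norm x))) (at x)"
    by (intro has_derivative_mult bounded_linear_imp_has_derivative bounded_linear_vec_nth)
  moreover have "x $ i * ((h \<bullet> sgn x) * (norm x * m (norm x))) + h $ i * k (norm x)
      = h $ i * k (norm x) + x $ i * (m (norm x) * (x \<bullet> h))" for h
    using False by (simp add: sgn_div_norm inner_commute)
  ultimately show ?thesis by simp
qed

lemma partial_deriv_radial_field: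
  "partial_deriv j (\<lambda>x. x $ i * k (norm x)) x
     = (if i = j then k (norm x) else 0) + x $ i * x $ j * m (norm x)"
  unfolding partial_deriv_def
  by (subst frechet_derivative_at[OF has_derivative_radial_field, symmetric])
     (auto simp: inner_axis, auto simp: axis_def)

text \<open>Differentiability is assumed for positive arguments only; below \<open>a\<close> the
  profile is locally constant, and the two ranges cover the line.\<close>

lemma continuous_radial_profile: "continuous_on UNIV k"
proof -
  have "isCont k s" for s
  proof (cases "s < a")
    case True
    have "eventually (\<lambda>t. k t = 0) (nhds s)"
      using eventually_nhds_in_open[of "{..<a}" s] True by (auto elim!: eventually_mono simp: zero)
    then show ?thesis using isCont_cong by fastforce
  next
    case False
    then show ?thesis using k[of s] a by (intro DERIV_isCont) auto
  qed
  then show ?thesis by (simp add: continuous_at_imp_continuous_on)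
qed

lemma radial_field_in_C1_compact_support:
  "(\<lambda>x. x $ i * k (norm x)) \<in> C1_compact_support"
  unfolding C1_compact_support_def
proof (intro CollectI conjI allI)
  show "(\<lambda>x. x $ i * k (norm x)) differentiable at x" for x
    using has_derivative_radial_field by (rule differentiableI)
  show "continuous_on UNIV (partial_deriv j (\<lambda>x. x $ i * k (norm x)))" for j
    unfolding partial_deriv_radial_field[abs_def]
    by (cases "i = j")
       (auto intro!: continuous_intros continuous_on_compose2[OF m] continuous_on_compose2[OF continuous_radial_profile])
  have "{x. x $ i * k (norm x) \<noteq> 0} \<subseteq> cball 0 b"
    using zero(3) by (fastforce simp: not_le intro: ccontr)
  then show "compact (closure {x. x $ i * k (norm x) \<noteq> 0})"
    unfolding compact_closure using bounded_cball bounded_subset by blast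
qed

end

text \<open>The i-th component of the field y h(|y|)/|y|^d is tested against the i-th derivative
  measure, and summing over i produces the divergence on the left. Each component is at most a^(1-d)
  in modulus and vanishes where |y| < a.\<close>

lemma abs_integral_divergence_le:
  fixes f :: "real ^ 'n::finite \<Rightarrow> real" and h h' :: "real \<Rightarrow> real"
  assumes f: "integrable lebesgue f" and \<mu>: "\<And>i. has_measure_deriv f i (\<mu> i)"
    and a: "0 < a" and h: "\<And>s. (h has_real_derivative h' s) (at s)" and h': "continuous_on UNIV h'"
    and zero: "\<And>s. s \<le> a \<Longrightarrow> h s = 0" "\<And>s. s \<le> a \<Longrightarrow> h' s = 0"
      "\<And>s. b \<le> s \<Longrightarrow> h s = 0" "\<And>s. b \<le> s \<Longrightarrow> h' s = 0"
    and h1: "\<And>s. \<bar>h s\<bar> \<le> 1"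
  shows "\<bar>\<integral>x. f x * (h' (norm x) / norm x ^ (CARD('n) - 1)) \<partial>lebesgue\<bar>
    \<le> (\<Sum>i\<in>UNIV. enn2real (variation (\<mu> i) {x. a \<le> norm x})) / a ^ (CARD('n) - 1)"
proof -
  define d where "d = CARD('n)"
  have d0: "0 < d" by (simp add: d_def)
  define k where "k = (\<lambda>s. h s / s ^ d)"
  \<comment> \<open>This is the quotient rule for \<open>k\<close>, divided by
    \<open>s\<close>.\<close>
  define m where "m = (\<lambda>s. h' s / s ^ (d + 1) - real d * h s / s ^ (d + 2))"
  have kd: "(k has_real_derivative s * m s) (at s)" if "0 < s" for s
  proof -
    have "(k has_real_derivative (h' s * s ^ d - h s * (real d * s ^ (d - 1))) / (s ^ d * s ^ d)) (at s)"
      unfolding k_def using that by (auto intro!: derivative_eq_intros h)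
    moreover have "(h' s * s ^ d - h s * (real d * s ^ (d - 1))) / (s ^ d * s ^ d) = s * m s"
      using that d0 by (cases d) (auto simp: m_def field_simps)
    ultimately show ?thesis by simp
  qed
  \<comment> \<open>The formula is continuous for positive arguments, and \<open>m\<close> vanishes
    below \<open>a\<close>; the two open sets overlap.\<close>
  have mc: "continuous_on UNIV m"
  proof -
    have hc: "continuous_on A h" for A
      using h DERIV_isCont continuous_at_imp_continuous_on by blast
    have "continuous_on {0<..} m"
      unfolding m_def by (intro continuous_intros hc continuous_on_subset[OF h']) auto
    moreover have "continuous_on {..<a} m"
      by (rule continuous_on_eq[where f = "\<lambda>_. 0"]) (auto simp: m_def zero)
    moreover have "{0<..} \<union> {..<a} = UNIV" using a by auto
    ultimately show ?thesis using continuous_on_open_Un[of "{0<..}" "{..<a}" m] by simp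
  qed
  have kz: "s \<le> a \<Longrightarrow> k s = 0" "s \<le> a \<Longrightarrow> m s = 0" "b \<le> s \<Longrightarrow> k s = 0" "b \<le> s \<Longrightarrow> m s = 0" for s
    by (auto simp: k_def m_def zero)
  define \<phi> where "\<phi> = (\<lambda>i (x::real^'n). x $ i * k (norm x))"
  have \<phi>C: "\<phi> i \<in> C1_compact_support" for i
    unfolding \<phi>_def using a kd mc kz(1-3) by (rule radial_field_in_C1_compact_support)
  have pd: "partial_deriv i (\<phi> i) x = k (norm x) + x $ i * x $ i * m (norm x)" for i x
    unfolding \<phi>_def using partial_deriv_radial_field[OF a kd mc kz(1-3), where i = i and j = i] by simp
  have int: "integrable lebesgue (\<lambda>x. f x * partial_deriv i (\<phi> i) x)" for i
  proof -
    have c: "continuous_on UNIV (partial_deriv i (\<phi> i))"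
      using \<phi>C by (auto simp: C1_compact_support_def)
    have "bounded (partial_deriv i (\<phi> i) ` cball 0 b)"
      using c by (intro compact_imp_bounded compact_continuous_image) (auto intro: continuous_on_subset)
    then obtain B where B: "\<And>x. x \<in> cball 0 b \<Longrightarrow> \<bar>partial_deriv i (\<phi> i) x\<bar> \<le> B"
      by (fastforce simp: bounded_iff)
    have "\<bar>partial_deriv i (\<phi> i) x\<bar> \<le> max B 0" for x
      using B[of x] kz(3,4)[of "norm x"] by (cases "norm x \<le> b") (auto simp: pd)
    moreover have "partial_deriv i (\<phi> i) \<in> borel_measurable lebesgue"
      using borel_measurable_continuous_onI[OF c] by (simp add: measurable_completion)
    ultimately show ?thesis using f by (intro integrable_mult_bounded)
  qed
  \<comment> \<open>The sum is d k(|x|) + |x|^2 m(|x|), in which the terms containing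
    \<open>h\<close> cancel.\<close>
  have div: "(\<Sum>i\<in>UNIV. partial_deriv i (\<phi> i) x) = h' (norm x) / norm x ^ (d - 1)" for x
  proof (cases "x = 0")
    case True
    then show ?thesis using a by (simp add: pd kz zero)
  next
    case False
    have "(\<Sum>i\<in>UNIV. x $ i * x $ i) = (norm x)\<^sup>2"
      by (simp add: power2_norm_eq_inner inner_vec_def)
    then have "(\<Sum>i\<in>UNIV. partial_deriv i (\<phi> i) x) = real d * k (norm x) + (norm x)\<^sup>2 * m (norm x)"
      by (simp add: pd sum.distrib sum_distrib_right[symmetric] d_def)
    also have "\<dots> = h' (norm x) / norm x ^ (d - 1)"
      using False d0 by (cases d) (auto simp: k_def m_def field_simps power2_eq_square)
    finally show ?thesis .
  qed
  have \<phi>b: "\<bar>\<phi> i x\<bar> \<le> (1 / a ^ (d - 1)) * indicator {x. a \<le> norm x} x" for i x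
  proof (cases "a \<le> norm x")
    case True
    have "\<bar>\<phi> i x\<bar> = \<bar>x $ i\<bar> * (\<bar>h (norm x)\<bar> / norm x ^ d)" by (simp add: \<phi>_def k_def abs_mult)
    also have "\<dots> \<le> norm x * (1 / norm x ^ d)"
      using h1 by (intro mult_mono component_le_norm_cart divide_right_mono) auto
    also have "\<dots> = 1 / norm x ^ (d - 1)" using True a d0 by (cases d) auto
    also have "\<dots> \<le> 1 / a ^ (d - 1)" using True a
      by (intro divide_left_mono power_mono mult_pos_pos zero_less_power) (auto intro: less_le_trans simp del: zero_less_norm_iff)
    finally show ?thesis using True by simp
  qed (simp add: \<phi>_def kz)
  have closed: "closed {x::real^'n. a \<le> norm x}" by (intro closed_Collect_le continuous_intros)
  have "(\<integral>x. f x * (h' (norm x) / norm x ^ (d - 1)) \<partial>lebesgue)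
      = (\<integral>x. (\<Sum>i\<in>UNIV. f x * partial_deriv i (\<phi> i) x) \<partial>lebesgue)"
    by (simp only: div[symmetric] sum_distrib_left)
  also have "\<dots> = (\<Sum>i\<in>UNIV. \<integral>x. f x * partial_deriv i (\<phi> i) x \<partial>lebesgue)"
    using int by (intro Bochner_Integration.integral_sum) auto
  also have "\<dots> = (\<Sum>i\<in>UNIV. - signed_integral (\<mu> i) (\<phi> i))"
    using \<mu> \<phi>C by (intro sum.cong) (auto simp: has_measure_deriv_def)
  finally have "\<bar>\<integral>x. f x * (h' (norm x) / norm x ^ (d - 1)) \<partial>lebesgue\<bar>
      \<le> (\<Sum>i\<in>UNIV. \<bar>signed_integral (\<mu> i) (\<phi> i)\<bar>)"
    using sum_abs[of "\<lambda>i. - signed_integral (\<mu> i) (\<phi> i)" UNIV] by simp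
  also have "\<dots> \<le> (\<Sum>i\<in>UNIV. (1 / a ^ (d - 1)) * enn2real (variation (\<mu> i) {x. a \<le> norm x}))"
    using \<mu> \<phi>b a closed
    by (intro sum_mono abs_signed_integral_le) (auto simp: has_measure_deriv_def)
  finally show ?thesis by (simp add: d_def sum_divide_distrib)
qed

section \<open>Values at Lebesgue points\<close>

text \<open>Rotations preserve null sets, so f' composed with T agrees almost everywhere with g
  composed with T, which is g, and hence with f'. Thus a Borel representative inherits radial
  symmetry almost everywhere.\<close>

lemma radial_borel_representative:
  fixes f g :: "'a::euclidean_space \<Rightarrow> real"
  assumes f: "f \<in> borel_measurable lebesgue" and rad: "\<And>x y. norm x = norm y \<Longrightarrow> g x = g y"
    and fg: "AE x in lebesgue. f x = g x"
  obtains f' where "f' \<in> borel_measurable borel" "AE x in lebesgue. f x = f' x"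
    "\<And>T. orthogonal_transformation T \<Longrightarrow> AE x in lborel. f' (T x) = f' x"
proof -
  obtain f' where f'[measurable]: "f' \<in> borel_measurable borel" and ff': "AE x in lborel. f x = f' x"
    using completion_ex_borel_measurable_real[OF f] by auto
  have "AE x in lborel. f x = g x" using fg by (simp add: AE_completion_iff)
  with ff' have gf': "AE x in lborel. f' x = g x" by eventually_elim simp
  show ?thesis
  proof (rule that[OF f' AE_completion[OF ff']])
    fix T :: "'a \<Rightarrow> 'a" assume T: "orthogonal_transformation T"
    have "T \<in> borel_measurable borel"
      using T by (intro borel_measurable_continuous_onI linear_continuous_on
        linear_conv_bounded_linear[THEN iffD1] orthogonal_transformation_linear)
    then have "T \<in> borel_measurable lborel" by simp
    moreover have "AE x in distr lborel borel T. f' x = g x"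
      by (subst distr_lborel_orthogonal_transformation[OF T]) (rule gf')
    ultimately have "AE x in lborel. f' (T x) = g (T x)" by (rule AE_distrD)
    with gf' show "AE x in lborel. f' (T x) = f' x"
    proof eventually_elim
      case (elim x)
      then show ?case using rad[OF orthogonal_transformation_norm[OF T], of x] by simp
    qed
  qed
qed

lemma integral_lebesgue_cong_borel:
  fixes f g :: "'a::euclidean_space \<Rightarrow> real"
  assumes f: "f \<in> borel_measurable lebesgue" and g: "g \<in> borel_measurable borel"
    and fg: "AE x in lebesgue. f x = g x"
  shows "(\<integral>x. f x \<partial>lebesgue) = (\<integral>x. g x \<partial>lborel)"
    and "integrable lebesgue f \<longleftrightarrow> integrable lborel g"
proof -
  have g': "g \<in> borel_measurable lborel" "g \<in> borel_measurable lebesgue"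
    using g by (auto intro: measurable_completion)
  show "(\<integral>x. f x \<partial>lebesgue) = (\<integral>x. g x \<partial>lborel)"
    using integral_cong_AE[OF f g'(2) fg] integral_completion[OF g'(1)] by simp
  show "integrable lebesgue f \<longleftrightarrow> integrable lborel g"
    using integrable_cong_AE[OF f g'(2) fg] integrable_completion[OF g'(1)] by simp
qed

lemma measure_shell:
  fixes s t :: real
  assumes "0 \<le> s" "s \<le> t"
  shows "measure lborel {y::'a::euclidean_space. s < norm y \<and> norm y < t}
    = unit_ball_vol DIM('a) * (t ^ DIM('a) - s ^ DIM('a))"
\<comment> \<open>For \<open>s = t\<close> the closed ball is not contained in the open one, so the
  measures cannot be subtracted.\<close>
proof (cases "s = t")
  case False
  have "{y::'a. s < norm y \<and> norm y < t} = ball 0 t - cball 0 s" by auto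
  moreover have "measure lborel (ball 0 t - cball (0::'a) s) = measure lborel (ball (0::'a) t) - measure lborel (cball (0::'a) s)"
    using assms False by (intro measure_Diff) (auto simp: emeasure_ball emeasure_cball)
  ultimately show ?thesis using assms by (simp add: content_ball content_cball algebra_simps)
next
  case True
  have empty: "{y::'a. t < norm y \<and> norm y < t} = {}" by auto
  show ?thesis unfolding True empty by simp
qed

text \<open>The divergence of the test field with profile
  \<open>ramp ((s - r) / \<epsilon>)\<close>. It serves twice: with width \<epsilon> at radius r for
  the rise, and with width R at radius R for the fall.\<close>

definition shell_weight :: "real \<Rightarrow> real \<Rightarrow> real ^ 'n::finite \<Rightarrow> real" where
  "shell_weight r \<epsilon> y = tent ((norm y - r) / \<epsilon>) / \<epsilon> / norm y ^ (CARD('n) - 1)"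

text \<open>In polar coordinates the total mass is d times the volume of the unit ball. The lower
  bound loses a factor 2^d but depends on neither r nor \<epsilon>, which makes the final constant
  uniform.\<close>

lemma shell_weight:
  fixes r \<epsilon> :: real
  assumes r: "0 < r" and \<epsilon>: "0 < \<epsilon>" "\<epsilon> \<le> r"
  defines "w \<equiv> shell_weight r \<epsilon> :: real^'n::finite \<Rightarrow> real"
  shows "integrable lborel w"
    and "unit_ball_vol CARD('n) * CARD('n) / 2 ^ CARD('n) \<le> (\<integral>y. w y \<partial>lborel)"
    and "\<And>y. w y \<le> 2 / \<epsilon> / r ^ (CARD('n) - 1) * indicator {y. r < norm y \<and> norm y < r + \<epsilon>} y"
    and "\<And>y. 0 \<le> w y"
    and "w \<in> borel_measurable borel"
proof -
  let ?d = "CARD('n)" and ?S = "{y::real^'n. r < norm y \<and> norm y < r + \<epsilon>}"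
  let ?A = "{y::real^'n. r + \<epsilon>/4 < norm y \<and> norm y < r + 3*\<epsilon>/4}"
  show w0: "0 \<le> w y" for y using tent_bounds \<epsilon> by (simp add: w_def shell_weight_def)
  show w1: "w y \<le> 2 / \<epsilon> / r ^ (?d - 1) * indicator ?S y" for y
  proof (cases "y \<in> ?S")
    case True
    have "w y \<le> 2 / \<epsilon> / norm y ^ (?d - 1)"
      unfolding w_def shell_weight_def using tent_bounds \<epsilon> by (intro divide_right_mono) auto
    also have "\<dots> \<le> 2 / \<epsilon> / r ^ (?d - 1)"
      using True r \<epsilon>
        by (intro divide_left_mono power_mono mult_pos_pos zero_less_power)
           (auto simp del: zero_less_norm_iff)
    finally show ?thesis using True by simp
  next
    case False
    then have "tent ((norm y - r) / \<epsilon>) = 0" using \<epsilon> by (intro tent_eq_0) (auto simp: field_simps)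
    then show ?thesis using False by (simp add: w_def shell_weight_def)
  qed
  have [measurable]: "tent \<in> borel_measurable borel"
    by (intro borel_measurable_continuous_onI continuous_tent)
  show wm[measurable]: "w \<in> borel_measurable borel"
    unfolding w_def shell_weight_def[abs_def] by measurable
  have fin: "emeasure lborel {y::real^'n. s < norm y \<and> norm y < t} < \<infinity>" for s t
    by (rule le_less_trans[OF emeasure_mono[of _ "ball 0 t"]])
       (use emeasure_lborel_ball_finite[of 0 t] in auto)
  show wi: "integrable lborel w"
  proof (rule Bochner_Integration.integrable_bound)
    show "integrable lborel (\<lambda>y. 2 / \<epsilon> / r ^ (?d - 1) * indicator ?S y)"
      using fin by (intro integrable_mult_right integrable_real_indicator) auto
    show "AE y in lborel. norm (w y) \<le> norm (2 / \<epsilon> / r ^ (?d - 1) * indicator ?S y)"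
      using w0 w1 r \<epsilon> by (simp add: abs_mult)
  qed simp
  \<comment> \<open>Only the middle half \<open>?A\<close> of the shell is used, where
    \<open>tent\<close> is at least 1. One factor 1/2 is lost through its width, the other d - 1
    through |y| \<le> 2 r.\<close>
  have "unit_ball_vol ?d * ?d / 2 ^ ?d * r ^ (?d - 1) * 2 ^ (?d - 1) = unit_ball_vol ?d * (?d * r ^ (?d - 1) * (\<epsilon> / 2)) / \<epsilon>"
    using \<epsilon> power_Suc[of "2::real" "?d - 1"] by (simp add: field_simps)
  also have "\<dots> \<le> unit_ball_vol ?d * ((r + 3*\<epsilon>/4) ^ ?d - (r + \<epsilon>/4) ^ ?d) / \<epsilon>"
  proof (intro divide_right_mono mult_left_mono)
    have "?d * r ^ (?d - 1) * (\<epsilon> / 2) \<le> ?d * (r + \<epsilon>/4) ^ (?d - 1) * ((r + 3*\<epsilon>/4) - (r + \<epsilon>/4))"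
      using r \<epsilon> by (intro mult_mono power_mono) auto
    also have "\<dots> \<le> (r + 3*\<epsilon>/4) ^ ?d - (r + \<epsilon>/4) ^ ?d"
      using r \<epsilon> by (intro power_diff_ge) auto
    finally show "?d * r ^ (?d - 1) * (\<epsilon> / 2) \<le> (r + 3*\<epsilon>/4) ^ ?d - (r + \<epsilon>/4) ^ ?d" .
  qed (use \<epsilon> in auto)
  also have "\<dots> = measure lborel ?A / \<epsilon>"
    using r \<epsilon> by (subst measure_shell) auto
  also have "\<dots> = (\<integral>y. 1 / \<epsilon> * indicator ?A y \<partial>lborel)"
    using fin by simp
  also have "\<dots> \<le> (\<integral>y. (2 * r) ^ (?d - 1) * w y \<partial>lborel)"
  proof (intro integral_mono' integrable_mult_right wi)
    fix y :: "real^'n"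
    show "0 \<le> (2 * r) ^ (?d - 1) * w y" using w0 r by simp
    show "1 / \<epsilon> * indicator ?A y \<le> (2 * r) ^ (?d - 1) * w y"
    proof (cases "y \<in> ?A")
      case True
      have t: "1 \<le> tent ((norm y - r) / \<epsilon>)"
        using True \<epsilon> by (intro tent_ge_1) (auto simp: field_simps)
      have "1 / \<epsilon> * norm y ^ (?d - 1) \<le> tent ((norm y - r) / \<epsilon>) / \<epsilon> * (2 * r) ^ (?d - 1)"
        using True r \<epsilon> t by (intro mult_mono power_mono divide_right_mono) auto
      moreover have "0 < norm y ^ (?d - 1)" using True r \<epsilon> by (intro zero_less_power) auto
      ultimately show ?thesis using True by (simp add: w_def shell_weight_def pos_le_divide_eq mult_ac)
    qed (use w0 r in simp)
  qed
  also have "\<dots> = (\<integral>y. w y \<partial>lborel) * r ^ (?d - 1) * 2 ^ (?d - 1)"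
    by (simp add: power_mult_distrib mult_ac)
  finally have "unit_ball_vol ?d * ?d / 2 ^ ?d * (r ^ (?d - 1) * 2 ^ (?d - 1))
      \<le> (\<integral>y. w y \<partial>lborel) * (r ^ (?d - 1) * 2 ^ (?d - 1))"
    by (simp only: mult.assoc)
  then show "unit_ball_vol ?d * ?d / 2 ^ ?d \<le> (\<integral>y. w y \<partial>lborel)"
    by (rule mult_right_le_imp_le) (use r in simp)
qed

text \<open>With weights w for the rise and v for the fall, f(x) times the integral of w equals the
  integral of f (w - v), plus that of f v, minus that of (f - f(x)) w. The three summands are
  bounded by the tail variation, by the L1 norm over R, and by the mean deviation near x.\<close>

lemma radial_value_le_up_to_error:
  fixes f g :: "real ^ 'n::finite \<Rightarrow> real" and x :: "real ^ 'n"
  assumes f: "integrable lebesgue f" and rad: "\<And>x y. norm x = norm y \<Longrightarrow> g x = g y"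
    and fg: "AE x in lebesgue. f x = g x"
    and \<mu>: "\<And>i. has_measure_deriv f i (\<mu> i)"
    and x: "norm x = r" and r: "0 < r" and \<epsilon>: "0 < \<epsilon>" "\<epsilon> \<le> r" and R: "r \<le> R"
  shows "unit_ball_vol CARD('n) * CARD('n) / 2 ^ CARD('n) * \<bar>f x\<bar>
    \<le> (\<Sum>i\<in>UNIV. enn2real (variation (\<mu> i) {y. r \<le> norm y})) / r ^ (CARD('n) - 1)
     + 2 / R / r ^ (CARD('n) - 1) * (\<integral>y. \<bar>f y\<bar> \<partial>lebesgue)
     + 4 * CARD('n) * 2 ^ (CARD('n) - 1) * unit_ball_vol CARD('n) * 7 ^ CARD('n)
       * ((LINT y:ball x (7 * \<epsilon>)|lebesgue. \<bar>f y - f x\<bar>) / measure lebesgue (ball x (7 * \<epsilon>)))"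
proof -
  let ?d = "CARD('n)" and ?S = "{y::real^'n. r < norm y \<and> norm y < r + \<epsilon>}"
  define c where "c = f x"
  define w :: "real^'n \<Rightarrow> real" where "w = shell_weight r \<epsilon>"
  define v :: "real^'n \<Rightarrow> real" where "v = shell_weight R R"
  have R0: "0 < R" using r R by simp
  note w = shell_weight[OF r \<epsilon>, where 'n = 'n, folded w_def]
  note v = shell_weight[OF R0 R0 order_refl, where 'n = 'n, folded v_def]
  have [measurable]: "f \<in> borel_measurable lebesgue" using f by simp
  obtain f' where f'm[measurable]: "f' \<in> borel_measurable borel" and ff': "AE y in lebesgue. f y = f' y"
    and inv: "\<And>T. orthogonal_transformation T \<Longrightarrow> AE y in lborel. f' (T y) = f' y"
    using radial_borel_representative[OF _ rad fg] f by auto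
  have f'i: "integrable lborel f'"
    using integral_lebesgue_cong_borel(2)[OF _ f'm ff'] f by simp
  \<comment> \<open>The Borel representative \<open>f'\<close> is compared with the value of
    \<open>f\<close> itself at \<open>x\<close>, since \<open>f'\<close> may differ from
    \<open>f\<close> there.\<close>
  define F where "F = (\<lambda>y. \<bar>f' y - c\<bar>)"
  have Fm[measurable]: "F \<in> borel_measurable borel" unfolding F_def by measurable
  have Fi: "integrable lborel (\<lambda>y. indicator (ball z s) y * F y)" for z s
  proof -
    have "integrable lborel (\<lambda>y. indicator (ball z s) y * (f' y - c))"
      unfolding right_diff_distrib
      using f'i emeasure_lborel_ball_finite[of z s] integrable_mult_indicator[of "ball z s" lborel f']
      by (intro Bochner_Integration.integrable_diff integrable_mult_left integrable_real_indicator)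
         (auto simp: emeasure_lborel_ball_finite)
    from integrable_abs[OF this] show ?thesis by (simp add: F_def abs_mult)
  qed
  have wleb[measurable]: "w \<in> borel_measurable lebesgue" using w(5) by (simp add: measurable_completion)
  have [measurable]: "v \<in> borel_measurable lebesgue" using v(5) by (simp add: measurable_completion)
  have v_bound: "\<bar>v y\<bar> \<le> 2 / R / r ^ (?d - 1)" for y
  proof -
    have "v y \<le> 2 / R / R ^ (?d - 1) * 1"
      using v(3)[of y] R0
      by (elim order_trans) (intro mult_left_mono, auto simp: indicator_def)
    also have "\<dots> \<le> 2 / R / r ^ (?d - 1)"
      using r R R0 by (auto intro!: divide_left_mono power_mono mult_pos_pos zero_less_power)
    finally show ?thesis using v(4) by simp
  qed
  have w_bound: "\<bar>w y\<bar> \<le> 2 / \<epsilon> / r ^ (?d - 1)" for y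
  proof -
    have "w y \<le> 2 / \<epsilon> / r ^ (?d - 1) * 1"
      using w(3)[of y] r \<epsilon>
      by (elim order_trans) (intro mult_left_mono, auto simp: indicator_def)
    then show ?thesis using w(4) by simp
  qed
  have fwi: "integrable lebesgue (\<lambda>y. f y * w y)" and fvi: "integrable lebesgue (\<lambda>y. f y * v y)"
    using integrable_mult_bounded[OF f _ w_bound] integrable_mult_bounded[OF f _ v_bound] by auto
  have wi: "integrable lebesgue w" using w(1,5) by (simp add: integrable_completion)

  have test: "\<bar>\<integral>y. f y * (w y - v y) \<partial>lebesgue\<bar>
      \<le> (\<Sum>i\<in>UNIV. enn2real (variation (\<mu> i) {y. r \<le> norm y})) / r ^ (?d - 1)"
  proof -
    \<comment> \<open>Both ramps take values in [0, 1] and both equal 1 from 2 R on, because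
      \<epsilon> \<le> r \<le> R; hence the profile is bounded by 1 and vanishes there.\<close>
    let ?h = "\<lambda>s. ramp ((s - r) / \<epsilon>) - ramp ((s - R) / R)"
    let ?h' = "\<lambda>s. tent ((s - r) / \<epsilon>) / \<epsilon> - tent ((s - R) / R) / R"
    have ramp': "((\<lambda>s. ramp ((s - p) / q)) has_real_derivative tent ((s - p) / q) / q) (at s)"
      if "0 < q" for p q s
    proof -
      have "((\<lambda>s. (s - p) / q) has_real_derivative 1 / q) (at s)"
        using that by (auto intro!: derivative_eq_intros)
      from DERIV_chain2[OF has_real_derivative_ramp this] show ?thesis by simp
    qed
    have "\<bar>\<integral>y. f y * (?h' (norm y) / norm y ^ (?d - 1)) \<partial>lebesgue\<bar>
      \<le> (\<Sum>i\<in>UNIV. enn2real (variation (\<mu> i) {y. r \<le> norm y})) / r ^ (?d - 1)"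
    proof (rule abs_integral_divergence_le[where h = ?h and h' = ?h' and b = "2 * R", OF f \<mu> r])
      show "(?h has_real_derivative ?h' s) (at s)" for s
        using ramp'[OF \<epsilon>(1)] ramp'[OF R0] by (intro DERIV_diff)
      show "continuous_on UNIV ?h'"
        using \<epsilon> R0 by (intro continuous_intros continuous_on_compose2[OF continuous_tent]) auto
      show "?h s = 0" "?h' s = 0" if "s \<le> r" for s
        using that \<epsilon> R R0 by (simp_all add: ramp_eq_0 tent_eq_0 divide_le_0_iff)
      have "1 \<le> (s - r) / \<epsilon>" "1 \<le> (s - R) / R" if "2 * R \<le> s" for s
        using that \<epsilon> R R0 by (simp_all add: field_simps)
      then show "?h s = 0" "?h' s = 0" if "2 * R \<le> s" for s
        using that by (simp_all add: ramp_eq_1 tent_eq_0)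
      show "\<bar>?h s\<bar> \<le> 1" for s
        using ramp_bounds[of "(s - r) / \<epsilon>"] ramp_bounds[of "(s - R) / R"] by linarith
    qed
    then show ?thesis by (simp add: w_def v_def shell_weight_def diff_divide_distrib)
  qed

  have v_int: "\<bar>\<integral>y. f y * v y \<partial>lebesgue\<bar> \<le> 2 / R / r ^ (?d - 1) * (\<integral>y. \<bar>f y\<bar> \<partial>lebesgue)"
  proof -
    have "\<bar>\<integral>y. f y * v y \<partial>lebesgue\<bar> \<le> (\<integral>y. \<bar>f y * v y\<bar> \<partial>lebesgue)" by (rule integral_abs_bound)
    also have "\<dots> \<le> (\<integral>y. 2 / R / r ^ (?d - 1) * \<bar>f y\<bar> \<partial>lebesgue)"
    proof (rule integral_mono)
      fix y
      show "\<bar>f y * v y\<bar> \<le> 2 / R / r ^ (?d - 1) * \<bar>f y\<bar>"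
        using mult_right_mono[OF v_bound, of "\<bar>f y\<bar>" y] by (simp only: abs_mult mult.commute abs_ge_zero)
    qed (intro integrable_abs integrable_mult_right f fvi)+
    finally show ?thesis by simp
  qed

  have ball_int: "(\<integral>y. indicator (ball x (7 * \<epsilon>)) y * F y \<partial>lborel)
      = (LINT y:ball x (7 * \<epsilon>)|lebesgue. \<bar>f y - f x\<bar>)"
    unfolding set_lebesgue_integral_def
  proof (intro integral_lebesgue_cong_borel(1)[symmetric])
    show "AE y in lebesgue. indicator (ball x (7 * \<epsilon>)) y *\<^sub>R \<bar>f y - f x\<bar> = indicator (ball x (7 * \<epsilon>)) y * F y"
      using ff' by eventually_elim (simp add: F_def c_def)
  qed (auto intro!: borel_measurable_scaleR borel_measurable_times borel_measurable_indicator)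
  define A where "A = (LINT y:ball x (7 * \<epsilon>)|lebesgue. \<bar>f y - f x\<bar>) / measure lebesgue (ball x (7 * \<epsilon>))"
  have "measure lebesgue (ball x (7 * \<epsilon>)) = unit_ball_vol ?d * 7 ^ ?d * \<epsilon> ^ ?d"
    using \<epsilon> by (simp add: content_ball power_mult_distrib)
  then have ball_A: "(\<integral>y. indicator (ball x (7 * \<epsilon>)) y * F y \<partial>lborel) = A * (unit_ball_vol ?d * 7 ^ ?d * \<epsilon> ^ ?d)"
    using \<epsilon> less_imp_neq[OF unit_ball_vol_pos[of "real ?d", OF of_nat_0_le_iff]]
    by (simp add: A_def ball_int)
  have F0: "0 \<le> F y" for y by (simp add: F_def)
  have "0 \<le> (\<integral>y. indicator (ball x (7 * \<epsilon>)) y * F y \<partial>lborel)"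
    by (intro Bochner_Integration.integral_nonneg mult_nonneg_nonneg F0 indicator_pos_le)
  then have A0: "0 \<le> A" unfolding A_def ball_int by (rule divide_nonneg_nonneg) (rule measure_nonneg)
  \<comment> \<open>The ball volume supplies \<epsilon>^d, which cancels the same power on the left.
    What remains is of order \<epsilon>, enough to absorb the factor 1/\<epsilon> in the bound for
    \<open>w\<close>.\<close>
  have "\<epsilon> ^ ?d * (\<integral>y. indicator ?S y * F y \<partial>lborel)
      \<le> ((r + \<epsilon>) ^ ?d - (r - \<epsilon>) ^ ?d) * (A * (unit_ball_vol ?d * 7 ^ ?d * \<epsilon> ^ ?d))"
    unfolding ball_A[symmetric]
  proof (rule shell_integral_le_ball_integral[OF Fm F0 _ Fi x \<epsilon>])
    show "AE y in lborel. F (T y) = F y" if "orthogonal_transformation T" for T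
      using inv[OF that] by eventually_elim (simp add: F_def)
  qed
  also have "\<dots> \<le> (?d * (2 * r) ^ (?d - 1) * (2 * \<epsilon>)) * (A * (unit_ball_vol ?d * 7 ^ ?d * \<epsilon> ^ ?d))"
  proof (rule mult_right_mono)
    have "(r + \<epsilon>) ^ ?d - (r - \<epsilon>) ^ ?d \<le> ?d * (r + \<epsilon>) ^ (?d - 1) * ((r + \<epsilon>) - (r - \<epsilon>))"
      using \<epsilon> by (intro power_diff_le) auto
    also have "\<dots> \<le> ?d * (2 * r) ^ (?d - 1) * (2 * \<epsilon>)"
      using \<epsilon> by (intro mult_mono power_mono) auto
    finally show "(r + \<epsilon>) ^ ?d - (r - \<epsilon>) ^ ?d \<le> ?d * (2 * r) ^ (?d - 1) * (2 * \<epsilon>)" .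
  qed (use A0 \<epsilon> in auto)
  also have "\<dots> = \<epsilon> ^ ?d * (?d * (2 * r) ^ (?d - 1) * (2 * \<epsilon>) * (A * (unit_ball_vol ?d * 7 ^ ?d)))"
    by simp
  finally have shell: "(\<integral>y. indicator ?S y * F y \<partial>lborel)
      \<le> ?d * (2 * r) ^ (?d - 1) * (2 * \<epsilon>) * (A * (unit_ball_vol ?d * 7 ^ ?d))"
    using \<epsilon> by simp

  have Fw_le: "w y * F y \<le> 2 / \<epsilon> / r ^ (?d - 1) * (indicator ?S y * F y)" for y
    using mult_right_mono[OF w(3) F0, of y y] by (simp add: mult.assoc)
  have SFi: "integrable lborel (\<lambda>y. indicator ?S y * F y)"
    by (rule Bochner_Integration.integrable_bound[OF Fi[of 0 "r + \<epsilon>"]]) (auto simp: F0 indicator_def)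
  have "\<bar>\<integral>y. (f y - c) * w y \<partial>lebesgue\<bar> \<le> (\<integral>y. \<bar>(f y - c) * w y\<bar> \<partial>lebesgue)"
    by (rule integral_abs_bound)
  also have "\<dots> = (\<integral>y. w y * F y \<partial>lborel)"
  proof (rule integral_lebesgue_cong_borel(1))
    show "AE y in lebesgue. \<bar>(f y - c) * w y\<bar> = w y * F y"
      using ff' by eventually_elim (use w(4) in \<open>simp add: abs_mult F_def\<close>)
  qed (use w(5) in measurable)
  also have "\<dots> \<le> (\<integral>y. 2 / \<epsilon> / r ^ (?d - 1) * (indicator ?S y * F y) \<partial>lborel)"
    using Fw_le SFi F0 r \<epsilon> by (intro integral_mono' integrable_mult_right) auto
  also have "\<dots> = 2 / \<epsilon> / r ^ (?d - 1) * (\<integral>y. indicator ?S y * F y \<partial>lborel)"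
    by simp
  also have "\<dots> \<le> 2 / \<epsilon> / r ^ (?d - 1) * (?d * (2 * r) ^ (?d - 1) * (2 * \<epsilon>) * (A * (unit_ball_vol ?d * 7 ^ ?d)))"
    using shell r \<epsilon> by (intro mult_left_mono) auto
  \<comment> \<open>The 4 combines the peak 2 of \<open>tent\<close> with the width 2 \<epsilon> of
    the shell containing the covering balls; 2^(d-1) comes from r + \<epsilon> \<le> 2 r and 7^d
    from the radius of the ball.\<close>
  also have "\<dots> = 4 * ?d * 2 ^ (?d - 1) * unit_ball_vol ?d * 7 ^ ?d * A"
  proof -
    have "2 / e / p * (D * (q * p) * (2 * e) * (A * (B * S))) = 4 * D * q * B * S * A"
      if "e \<noteq> 0" "p \<noteq> 0" for e p q D B S :: real
      using that by (simp add: field_simps)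
    from this[of \<epsilon> "r ^ (?d - 1)" "real ?d" "2 ^ (?d - 1)"] show ?thesis
      using r \<epsilon> by (simp add: power_mult_distrib)
  qed
  finally have dev: "\<bar>\<integral>y. (f y - c) * w y \<partial>lebesgue\<bar> \<le> 4 * ?d * 2 ^ (?d - 1) * unit_ball_vol ?d * 7 ^ ?d * A" .

  have "(\<integral>y. w y \<partial>lborel) = (\<integral>y. w y \<partial>lebesgue)" using w(5) by (simp add: integral_completion)
  then have "unit_ball_vol ?d * ?d / 2 ^ ?d * \<bar>c\<bar> \<le> (\<integral>y. w y \<partial>lebesgue) * \<bar>c\<bar>"
    using w(2) by (intro mult_right_mono) auto
  also have "\<dots> = \<bar>\<integral>y. c * w y \<partial>lebesgue\<bar>"
    using w(4) by (simp add: abs_mult integral_nonneg_AE mult.commute)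
  also have "(\<integral>y. c * w y \<partial>lebesgue) = (\<integral>y. f y * (w y - v y) \<partial>lebesgue) + (\<integral>y. f y * v y \<partial>lebesgue)
      - (\<integral>y. (f y - c) * w y \<partial>lebesgue)"
  proof -
    have "(\<integral>y. f y * (w y - v y) \<partial>lebesgue) = (\<integral>y. f y * w y \<partial>lebesgue) - (\<integral>y. f y * v y \<partial>lebesgue)"
      unfolding right_diff_distrib by (rule Bochner_Integration.integral_diff[OF fwi fvi])
    moreover have "(\<integral>y. (f y - c) * w y \<partial>lebesgue) = (\<integral>y. f y * w y \<partial>lebesgue) - (\<integral>y. c * w y \<partial>lebesgue)"
      unfolding left_diff_distrib
      by (rule Bochner_Integration.integral_diff[OF fwi integrable_mult_right[OF wi]])
    ultimately show ?thesis by linarith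
  qed
  also have "\<bar>\<dots>\<bar> \<le> \<bar>\<integral>y. f y * (w y - v y) \<partial>lebesgue\<bar> + \<bar>\<integral>y. f y * v y \<partial>lebesgue\<bar>
      + \<bar>\<integral>y. (f y - c) * w y \<partial>lebesgue\<bar>" by linarith
  also have "\<dots> \<le> (\<Sum>i\<in>UNIV. enn2real (variation (\<mu> i) {y. r \<le> norm y})) / r ^ (?d - 1)
     + 2 / R / r ^ (?d - 1) * (\<integral>y. \<bar>f y\<bar> \<partial>lebesgue)
     + 4 * ?d * 2 ^ (?d - 1) * unit_ball_vol ?d * 7 ^ ?d * A"
    by (intro add_mono test v_int dev)
  finally show ?thesis unfolding A_def c_def .
qed

text \<open>R tends to infinity while \<epsilon> is fixed, which removes the L1 term; then
  \<epsilon> tends to 0, and the mean deviation vanishes because x is a Lebesgue point. The other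
  two terms depend on neither parameter.\<close>

lemma radial_value_le_variation:
  fixes f g :: "real ^ 'n::finite \<Rightarrow> real" and x :: "real ^ 'n"
  assumes f: "integrable lebesgue f" and rad: "\<And>x y. norm x = norm y \<Longrightarrow> g x = g y"
    and fg: "AE x in lebesgue. f x = g x"
    and \<mu>: "\<And>i. has_measure_deriv f i (\<mu> i)"
    and x: "x \<noteq> 0" and leb: "lebesgue_point f x"
  shows "unit_ball_vol CARD('n) * CARD('n) / 2 ^ CARD('n) * \<bar>f x\<bar>
    \<le> (\<Sum>i\<in>UNIV. enn2real (variation (\<mu> i) {y. norm x \<le> norm y})) / norm x ^ (CARD('n) - 1)"
    (is "?L \<le> ?T")
proof -
  let ?r = "norm x"
  let ?A = "\<lambda>s. (LINT y:ball x s|lebesgue. \<bar>f y - f x\<bar>) / measure lebesgue (ball x s)"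
  define K where "K = real (4 * CARD('n)) * 2 ^ (CARD('n) - 1) * unit_ball_vol CARD('n) * 7 ^ CARD('n)"
  have r: "0 < ?r" using x by simp
  have main: "?L \<le> ?T + 2 / R / ?r ^ (CARD('n) - 1) * (\<integral>y. \<bar>f y\<bar> \<partial>lebesgue) + K * ?A (7 * \<epsilon>)"
    if "0 < \<epsilon>" "\<epsilon> \<le> ?r" "?r \<le> R" for \<epsilon> R
    using radial_value_le_up_to_error[OF f rad fg \<mu> refl r that] by (simp add: K_def)
  have step: "?L \<le> ?T + K * ?A (7 * \<epsilon>)" if \<epsilon>: "0 < \<epsilon>" "\<epsilon> \<le> ?r" for \<epsilon>
  proof (rule tendsto_lowerbound)
    have "((\<lambda>R::real. 2 / R) \<longlongrightarrow> 0) at_top"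
      by (intro tendsto_divide_0[OF tendsto_const] filterlim_at_top_imp_at_infinity filterlim_ident)
    then have "((\<lambda>R. ?T + 2 / R / ?r ^ (CARD('n) - 1) * (\<integral>y. \<bar>f y\<bar> \<partial>lebesgue) + K * ?A (7 * \<epsilon>))
        \<longlongrightarrow> ?T + 0 / ?r ^ (CARD('n) - 1) * (\<integral>y. \<bar>f y\<bar> \<partial>lebesgue) + K * ?A (7 * \<epsilon>)) at_top"
      using r by (intro tendsto_intros) auto
    then show "((\<lambda>R. ?T + 2 / R / ?r ^ (CARD('n) - 1) * (\<integral>y. \<bar>f y\<bar> \<partial>lebesgue) + K * ?A (7 * \<epsilon>))
        \<longlongrightarrow> ?T + K * ?A (7 * \<epsilon>)) at_top" by simp
    show "\<forall>\<^sub>F R in at_top. ?L \<le> ?T + 2 / R / ?r ^ (CARD('n) - 1) * (\<integral>y. \<bar>f y\<bar> \<partial>lebesgue) + K * ?A (7 * \<epsilon>)"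
      using eventually_ge_at_top[of ?r] by eventually_elim (rule main[OF \<epsilon>])
  qed simp
  show ?thesis
  proof (rule tendsto_lowerbound)
    have "(?A \<longlongrightarrow> 0) (at_right 0)" using leb by (simp add: lebesgue_point_def)
    moreover have "filterlim (\<lambda>\<epsilon>::real. 7 * \<epsilon>) (at_right 0) (at_right 0)"
      using filterlim_times_pos[OF filterlim_ident, of 7 0] by simp
    ultimately have "((\<lambda>\<epsilon>. ?A (7 * \<epsilon>)) \<longlongrightarrow> 0) (at_right 0)"
      by (rule filterlim_compose)
    then have "((\<lambda>\<epsilon>. ?T + K * ?A (7 * \<epsilon>)) \<longlongrightarrow> ?T + K * 0) (at_right 0)"
      by (intro tendsto_intros)
    then show "((\<lambda>\<epsilon>. ?T + K * ?A (7 * \<epsilon>)) \<longlongrightarrow> ?T) (at_right 0)" by simp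
    show "\<forall>\<^sub>F \<epsilon> in at_right 0. ?L \<le> ?T + K * ?A (7 * \<epsilon>)"
      using eventually_at_right_real[OF r] by eventually_elim (rule step; simp)
  qed simp
qed

section \<open>Uniform bound and decay from the tail variation\<close>

theorem theorem11:
  assumes "CARD('n::finite) \<ge> 2"
  shows "(\<exists>c::real. \<forall>f \<in> (RBV :: (real ^ 'n \<Rightarrow> real) set). \<forall>x. norm x > 0 \<longrightarrow>
            norm x ^ (CARD('n) - 1) * \<bar>lebesgue_rep f x\<bar> \<le> c * bv_norm f)
       \<and> (\<forall>f \<in> (RBV :: (real ^ 'n \<Rightarrow> real) set).
            ((\<lambda>x. norm x ^ (CARD('n) - 1) * \<bar>lebesgue_rep f x\<bar>) \<longlongrightarrow> 0) at_infinity)"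
proof -
  define \<kappa> where "\<kappa> = unit_ball_vol CARD('n) * CARD('n) / 2 ^ CARD('n)"
  have \<kappa>: "0 < \<kappa>" by (simp add: \<kappa>_def)
  define V where "V = (\<lambda>(f :: real ^ 'n \<Rightarrow> real) r.
    \<Sum>i\<in>UNIV. enn2real (variation (bv_deriv f i) {y. r \<le> norm y}))"
  \<comment> \<open>Membership in \<open>BV\<close> makes the choice behind \<open>bv_deriv\<close>
    a genuine derivative measure.\<close>
  have \<mu>: "has_measure_deriv f i (bv_deriv f i)" if "f \<in> RBV" for f :: "real ^ 'n \<Rightarrow> real" and i
    using that someI_ex[of "has_measure_deriv f i"] by (auto simp: RBV_def BV_def bv_deriv_def)
  have V0: "0 \<le> V f r" for f r by (simp add: V_def sum_nonneg)
  \<comment> \<open>At points that are not Lebesgue points the representative is 0 and the bound is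
    trivial. Since \<kappa> depends on the dimension only, 1/\<kappa> can serve as the
    constant.\<close>
  have key: "norm x ^ (CARD('n) - 1) * \<bar>lebesgue_rep f x\<bar> \<le> 1 / \<kappa> * V f (norm x)"
    if f: "f \<in> RBV" and x: "x \<noteq> 0" for f :: "real ^ 'n \<Rightarrow> real" and x
  proof (cases "lebesgue_point f x")
    case True
    obtain g where g: "\<And>x y. norm x = norm y \<Longrightarrow> g x = g y" "AE x in lebesgue. f x = g x"
      using f unfolding RBV_def by blast
    have "integrable lebesgue f" using f by (simp add: RBV_def BV_def)
    from radial_value_le_variation[OF this g \<mu>[OF f] x True]
    have "\<kappa> * \<bar>f x\<bar> \<le> V f (norm x) / norm x ^ (CARD('n) - 1)" by (simp add: \<kappa>_def V_def)
    then show ?thesis using \<kappa> x True by (simp add: lebesgue_rep_def field_simps)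
  qed (use \<kappa> V0 in \<open>simp add: lebesgue_rep_def\<close>)
  have "norm x ^ (CARD('n) - 1) * \<bar>lebesgue_rep f x\<bar> \<le> 1 / \<kappa> * bv_norm f"
    if f: "f \<in> RBV" and x: "0 < norm x" for f :: "real ^ 'n \<Rightarrow> real" and x
  proof -
    have "V f (norm x) \<le> (\<Sum>i\<in>UNIV. total_variation (bv_deriv f i))"
      unfolding V_def total_variation_def
    proof (intro sum_mono enn2real_mono)
      fix i
      have fin: "finite_signed_radon (bv_deriv f i)" using \<mu>[OF f] by (simp add: has_measure_deriv_def)
      then show "variation (bv_deriv f i) UNIV < top" by (simp add: finite_signed_radon_def)
      have "closed {y::real^'n. norm x \<le> norm y}" by (intro closed_Collect_le continuous_intros)
      then show "variation (bv_deriv f i) {y. norm x \<le> norm y} \<le> variation (bv_deriv f i) UNIV"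
        using fin by (intro variation_mono) (auto simp: finite_signed_radon_def)
    qed
    \<comment> \<open>The L1 part of the norm is nonnegative and is dropped.\<close>
    also have "\<dots> \<le> bv_norm f" by (simp add: bv_norm_def integral_nonneg_AE)
    finally have "1 / \<kappa> * V f (norm x) \<le> 1 / \<kappa> * bv_norm f"
      using \<kappa> by (intro mult_left_mono) auto
    with key[OF f] x show ?thesis by (auto intro: order_trans)
  qed
  moreover have "((\<lambda>x. norm x ^ (CARD('n) - 1) * \<bar>lebesgue_rep f x\<bar>) \<longlongrightarrow> 0) at_infinity"
    if f: "f \<in> RBV" for f :: "real ^ 'n \<Rightarrow> real"
  proof (rule tendsto_sandwich[of "\<lambda>_. 0" _ _ "\<lambda>x. 1 / \<kappa> * V f (norm x)"])
    have "(V f \<longlongrightarrow> (\<Sum>i\<in>(UNIV::'n set). 0)) at_top"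
      unfolding V_def using \<mu>[OF f]
      by (intro tendsto_sum variation_tail_tendsto_0) (simp add: has_measure_deriv_def)
    then have "((\<lambda>x::real^'n. V f (norm x)) \<longlongrightarrow> 0) at_infinity"
      using filterlim_compose[OF _ filterlim_norm_at_top] by simp
    from tendsto_mult_right_zero[OF this, of "1 / \<kappa>"]
    show "((\<lambda>x. 1 / \<kappa> * V f (norm x)) \<longlongrightarrow> 0) (at_infinity :: (real^'n) filter)" .
    \<comment> \<open>\<open>key\<close> excludes the origin, which is harmless at infinity.\<close>
    have "\<forall>\<^sub>F x in at_infinity. x \<noteq> (0::real^'n)"
      unfolding eventually_at_infinity by (intro exI[of _ 1]) auto
    then show "\<forall>\<^sub>F x in at_infinity. norm x ^ (CARD('n) - 1) * \<bar>lebesgue_rep f x\<bar> \<le> 1 / \<kappa> * V f (norm x)"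
      by eventually_elim (rule key[OF f])
  qed auto
  ultimately show ?thesis by blast
qed

end
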